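(* Let $p$ be a prime, $F$ a field of characteristic $p$, and let $\varphi,\psi$ be anisotropic quasilinear $p$-forms over $F$ that are weakly Vishik equivalent. Then $G_F(\varphi)=G_F(\psi)$.
   Context: A quasilinear $p$-form ($p$-form) over a field $F$ of characteristic $p>0$ is a map $\varphi:V\to F$ on a finite-dimensional $F$-vector space $V$ with $\varphi(av)=a^p\varphi(v)$ and $\varphi(v+w)=\varphi(v)+\varphi(w)$ for all $a\in F$, $v,w\in V$; $\dim\varphi=\dim V$. Isometry $\varphi\simeq\psi$ means there is a bijective linear map $f$ with $\varphi(v)=\psi(f(v))$ for all $v$. A form is isotropic if it vanishes at some nonzero vector, anisotropic otherwise. Every $p$-form decomposes as $\varphi\simeq\varphi_{\mathrm{an}}\perp k\times\langle0\rangle$ with $\varphi_{\mathrm{an}}$ anisotropic, unique up to isometry, where $k\times\langle0\rangle$ is the zero form of dimension $k$; $\mathfrak{i}_{\mathrm d}(\varphi):=k$ is the defect. For a field extension $E/F$, $\varphi_E$ is the $p$-form on $E\otimes_FV$ with $\varphi_E(e\otimes v)=e^p\varphi(v)$. Weak Vishik equivalence of $\varphi,\psi$: $\dim\varphi=\dim\psi$ and $\mathfrak{i}_{\mathrm d}(\varphi_{F(\sqrt[p]{a})})=\mathfrak{i}_{\mathrm d}(\psi_{F(\sqrt[p]{a})})$ for every $a\in F$. $G_F(\varphi)=\{x\in F^*\mid x\varphi\simeq\varphi\}\cup\{0\}$, where $(x\varphi)(v)=x\cdot\varphi(v)$. *)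

theory Defs
  imports
    "HOL-Algebra.Algebraic_Closure"
    "HOL-Algebra.Free_Abelian_Groups"
    "HOL-Algebra.Generated_Fields"
    "HOL-Algebra.Multiplicative_Group"
    "HOL-Computational_Algebra.Primes"
    "Jordan_Normal_Form.Missing_VectorSpace"
begin

section \<open>Quasilinear p-forms\<close>

definition has_characteristic :: "('a, 'm) ring_scheme \<Rightarrow> nat \<Rightarrow> bool" where
  "has_characteristic F p \<longleftrightarrow> group.ord (add_monoid F) \<one>\<^bsub>F\<^esub> = p"

locale quasilinear_form = vectorspace F V
  for p :: nat and F :: "'a ring" and V :: "('a, 'v) module" and \<phi> :: "'v \<Rightarrow> 'a" +
  assumes prime: "prime p"
    and characteristic: "has_characteristic F p"
    and finite_dimensional: "fin_dim"
    and form_closed: "\<phi> \<in> carrier V \<rightarrow> carrier F"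
    and form_smult: "a \<in> carrier F \<Longrightarrow> v \<in> carrier V \<Longrightarrow>
      \<phi> (a \<odot>\<^bsub>V\<^esub> v) = a [^]\<^bsub>F\<^esub> p \<otimes>\<^bsub>F\<^esub> \<phi> v"
    and form_add: "v \<in> carrier V \<Longrightarrow> w \<in> carrier V \<Longrightarrow>
      \<phi> (v \<oplus>\<^bsub>V\<^esub> w) = \<phi> v \<oplus>\<^bsub>F\<^esub> \<phi> w"

definition isometric ::
  "'a ring \<Rightarrow> ('a, 'v) module \<Rightarrow> ('v \<Rightarrow> 'a) \<Rightarrow> ('a, 'w) module \<Rightarrow> ('w \<Rightarrow> 'a) \<Rightarrow> bool" where
  "isometric F V \<phi> W \<psi> \<longleftrightarrow>
     (\<exists>f. linear_map F V W f \<and> bij_betw f (carrier V) (carrier W) \<and>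
          (\<forall>v\<in>carrier V. \<phi> v = \<psi> (f v)))"

definition isotropic :: "'a ring \<Rightarrow> ('a, 'v) module \<Rightarrow> ('v \<Rightarrow> 'a) \<Rightarrow> bool" where
  "isotropic F V \<phi> \<longleftrightarrow> (\<exists>v\<in>carrier V. v \<noteq> \<zero>\<^bsub>V\<^esub> \<and> \<phi> v = \<zero>\<^bsub>F\<^esub>)"

abbreviation anisotropic :: "'a ring \<Rightarrow> ('a, 'v) module \<Rightarrow> ('v \<Rightarrow> 'a) \<Rightarrow> bool" where
  "anisotropic F V \<phi> \<equiv> \<not> isotropic F V \<phi>"

text \<open>The form \<open>\<phi> \<perp> \<psi>\<close>; it lives on \<^const>\<open>direct_sum\<close> of the underlying spaces.\<close>

definition orthogonal_sum :: "'a ring \<Rightarrow> ('v \<Rightarrow> 'a) \<Rightarrow> ('w \<Rightarrow> 'a) \<Rightarrow> 'v \<times> 'w \<Rightarrow> 'a" where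
  "orthogonal_sum F \<phi> \<psi> = (\<lambda>(v, w). \<phi> v \<oplus>\<^bsub>F\<^esub> \<psi> w)"

text \<open>The defect is the \<open>k\<close> in \<open>\<phi> \<simeq> \<phi>_an \<perp> k \<times> \<langle>0\<rangle>\<close>. Here \<open>W\<close> carries the anisotropic
  part and \<open>U\<close> the zero form of dimension \<open>k\<close>. Both summands embed in \<open>V\<close>, so it is
  no restriction to take them over the element type of \<open>V\<close>.\<close>

definition defect :: "nat \<Rightarrow> 'a ring \<Rightarrow> ('a, 'v) module \<Rightarrow> ('v \<Rightarrow> 'a) \<Rightarrow> nat" where
  "defect p F V \<phi> =
     (THE k. \<exists>(W :: ('a, 'v) module) \<phi>an (U :: ('a, 'v) module).
        quasilinear_form p F W \<phi>an \<and> anisotropic F W \<phi>an \<and>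
        vectorspace F U \<and> vectorspace.fin_dim F U \<and> vectorspace.dim F U = k \<and>
        isometric F V \<phi> (direct_sum W U) (orthogonal_sum F \<phi>an (\<lambda>_. \<zero>\<^bsub>F\<^esub>)))"

definition similarity_factors ::
  "'a ring \<Rightarrow> ('a, 'v) module \<Rightarrow> ('v \<Rightarrow> 'a) \<Rightarrow> 'a set" where
  "similarity_factors F V \<phi> =
     {x \<in> carrier F - {\<zero>\<^bsub>F\<^esub>}. isometric F V (\<lambda>v. x \<otimes>\<^bsub>F\<^esub> \<phi> v) V \<phi>} \<union> {\<zero>\<^bsub>F\<^esub>}"

section \<open>Extension of scalars\<close>

text \<open>A field extension is given by a field \<open>E\<close> and an embedding \<open>\<iota>\<close> of \<open>F\<close> into \<open>E\<close>.
  The tensor product of \<open>E\<close> and \<open>V\<close> over \<open>F\<close> is the free abelian group on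
  \<open>carrier E \<times> carrier V\<close> modulo the subgroup generated by the bilinearity relations.\<close>

definition formal_tensors ::
  "'e ring \<Rightarrow> ('a, 'v) module \<Rightarrow> ('e \<times> 'v \<Rightarrow>\<^sub>0 int) monoid" where
  "formal_tensors E V = free_Abelian_group (carrier E \<times> carrier V)"

definition tensor_relations ::
  "'a ring \<Rightarrow> 'e ring \<Rightarrow> ('a \<Rightarrow> 'e) \<Rightarrow> ('a, 'v) module \<Rightarrow> ('e \<times> 'v \<Rightarrow>\<^sub>0 int) set" where
  "tensor_relations F E \<iota> V =
     {frag_of (e \<oplus>\<^bsub>E\<^esub> e', v) - frag_of (e, v) - frag_of (e', v) | e e' v.
        e \<in> carrier E \<and> e' \<in> carrier E \<and> v \<in> carrier V} \<union>
     {frag_of (e, v \<oplus>\<^bsub>V\<^esub> v') - frag_of (e, v) - frag_of (e, v') | e v v'.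
        e \<in> carrier E \<and> v \<in> carrier V \<and> v' \<in> carrier V} \<union>
     {frag_of (e \<otimes>\<^bsub>E\<^esub> \<iota> c, v) - frag_of (e, c \<odot>\<^bsub>V\<^esub> v) | e c v.
        e \<in> carrier E \<and> c \<in> carrier F \<and> v \<in> carrier V}"

definition tensor_null ::
  "'a ring \<Rightarrow> 'e ring \<Rightarrow> ('a \<Rightarrow> 'e) \<Rightarrow> ('a, 'v) module \<Rightarrow> ('e \<times> 'v \<Rightarrow>\<^sub>0 int) set" where
  "tensor_null F E \<iota> V = generate (formal_tensors E V) (tensor_relations F E \<iota> V)"

definition pure_tensor ::
  "'a ring \<Rightarrow> 'e ring \<Rightarrow> ('a \<Rightarrow> 'e) \<Rightarrow> ('a, 'v) module \<Rightarrow> 'e \<Rightarrow> 'v \<Rightarrow> ('e \<times> 'v \<Rightarrow>\<^sub>0 int) set" where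
  "pure_tensor F E \<iota> V e v =
     tensor_null F E \<iota> V #>\<^bsub>formal_tensors E V\<^esub> frag_of (e, v)"

text \<open>Scalars act by \<open>e \<odot> (e' \<otimes> v) = (e e') \<otimes> v\<close>; the union below is over the representatives of a
  coset, all of which yield the same coset. The multiplicative fields play no role in a
  module and are filled in as in \<^const>\<open>direct_sum\<close>.\<close>

definition scalar_extension ::
  "'a ring \<Rightarrow> 'e ring \<Rightarrow> ('a \<Rightarrow> 'e) \<Rightarrow> ('a, 'v) module \<Rightarrow> ('e, ('e \<times> 'v \<Rightarrow>\<^sub>0 int) set) module" where
  "scalar_extension F E \<iota> V =
     (let T = formal_tensors E V Mod tensor_null F E \<iota> V in
      \<lparr>carrier = carrier T,
       monoid.mult = (\<lambda>S S'. \<one>\<^bsub>T\<^esub>),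
       monoid.one = \<one>\<^bsub>T\<^esub>,
       ring.zero = \<one>\<^bsub>T\<^esub>,
       ring.add = (\<lambda>S S'. S \<otimes>\<^bsub>T\<^esub> S'),
       module.smult = (\<lambda>e S. \<Union>x\<in>S. tensor_null F E \<iota> V #>\<^bsub>formal_tensors E V\<^esub>
                  frag_extend (\<lambda>(e', v). frag_of (e \<otimes>\<^bsub>E\<^esub> e', v)) x)\<rparr>)"

text \<open>Extensionality only fixes the value outside the carrier, making the form unique as a
  function.\<close>

definition extended_form ::
  "nat \<Rightarrow> 'a ring \<Rightarrow> 'e ring \<Rightarrow> ('a \<Rightarrow> 'e) \<Rightarrow> ('a, 'v) module \<Rightarrow> ('v \<Rightarrow> 'a)
    \<Rightarrow> ('e \<times> 'v \<Rightarrow>\<^sub>0 int) set \<Rightarrow> 'e" where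
  "extended_form p F E \<iota> V \<phi> =
     (THE \<Phi>. quasilinear_form p E (scalar_extension F E \<iota> V) \<Phi> \<and>
             \<Phi> \<in> extensional (carrier (scalar_extension F E \<iota> V)) \<and>
             (\<forall>e\<in>carrier E. \<forall>v\<in>carrier V.
                \<Phi> (pure_tensor F E \<iota> V e v) = e [^]\<^bsub>E\<^esub> p \<otimes>\<^bsub>E\<^esub> \<iota> (\<phi> v)))"

section \<open>Weak Vishik equivalence\<close>

type_synonym 'a closure_elt = "('a list \<times> nat) multiset \<Rightarrow> 'a"

text \<open>HOL-Algebra's algebraic closure of \<open>F\<close> contains \<open>F\<close> via \<^const>\<open>ring.indexed_const\<close>.
  The root is unique because the characteristic is \<open>p\<close>.\<close>

abbreviation closure_embedding :: "'a ring \<Rightarrow> 'a \<Rightarrow> 'a closure_elt" where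
  "closure_embedding F \<equiv> ring.indexed_const F"

definition pth_root :: "nat \<Rightarrow> 'a ring \<Rightarrow> 'a \<Rightarrow> 'a closure_elt" where
  "pth_root p F a =
     (THE b. b \<in> carrier (field.alg_closure F) \<and>
             b [^]\<^bsub>field.alg_closure F\<^esub> p = closure_embedding F a)"

definition pth_root_extension :: "nat \<Rightarrow> 'a ring \<Rightarrow> 'a \<Rightarrow> 'a closure_elt ring" where
  "pth_root_extension p F a =
     (field.alg_closure F)
       \<lparr>carrier := generate_field (field.alg_closure F)
                    (closure_embedding F ` carrier F \<union> {pth_root p F a})\<rparr>"

definition weakly_Vishik_equivalent ::
  "nat \<Rightarrow> 'a ring \<Rightarrow> ('a, 'v) module \<Rightarrow> ('v \<Rightarrow> 'a) \<Rightarrow> ('a, 'w) module \<Rightarrow> ('w \<Rightarrow> 'a) \<Rightarrow> bool" where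
  "weakly_Vishik_equivalent p F V \<phi> W \<psi> \<longleftrightarrow>
     vectorspace.dim F V = vectorspace.dim F W \<and>
     (\<forall>a\<in>carrier F.
        let E = pth_root_extension p F a; \<iota> = closure_embedding F in
        defect p E (scalar_extension F E \<iota> V) (extended_form p F E \<iota> V \<phi>) =
        defect p E (scalar_extension F E \<iota> W) (extended_form p F E \<iota> W \<psi>))"

end

theory Submission imports Defs begin

text \<open>
  The whole statement depends only on value sets. Write \<open>D(\<phi>) = \<phi>(V)\<close>, an additive group on which
  the \<open>p\<close>-th powers of \<open>F\<close> act. For anisotropic \<open>\<phi>\<close> the map \<open>\<phi>\<close> is injective, because it is additive, so
  \<open>\<phi>\<close> identifies \<open>V\<close> with \<open>D(\<phi>)\<close>, and a nonzero \<open>x\<close> is a similarity factor exactly when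
  \<open>x D(\<phi>) \<subseteq> D(\<phi>)\<close> (\<open>similarity_factor_iff\<close>): an injective endomorphism of a finite-dimensional space is
  bijective.

  Let \<open>x\<close> be a nonzero similarity factor of \<open>\<phi>\<close> and let \<open>E = F(r)\<close> with \<open>r\<^sup>p = x\<close>. The elements \<open>e\<close> for which
  \<open>e\<^sup>p\<close> maps \<open>D(\<phi>)\<close> into itself form a field containing \<open>F\<close> and \<open>r\<close>, so \<open>E\<^sup>p\<close> preserves \<open>D(\<phi>)\<close>
  (\<open>radical_extension_stabilizes\<close>). Hence extending scalars creates no new values: \<open>D(\<phi>\<^sub>E) = D(\<phi>)\<close>.

  The defect is the dimension of the space of zeros of the form (\<open>defect_eq_dim_null_space\<close>), so the
  anisotropic part of \<open>\<phi>\<^sub>E\<close> has dimension \<open>dim V - defect\<close> and still has the value set \<open>D(\<phi>\<^sub>E)\<close>. For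
  equal defects, the anisotropic parts of \<open>\<phi>\<^sub>E\<close> and \<open>\<psi>\<^sub>E\<close> are therefore isomorphic over \<open>E\<close>, which gives a
  bijection from \<open>D(\<phi>\<^sub>E)\<close> to \<open>D(\<psi>\<^sub>E)\<close> compatible with addition and with the action of \<open>E\<^sup>p\<close>. Restricting
  the action to \<open>F\<^sup>p\<close>, the set \<open>D(\<psi>\<^sub>E)\<close> has the same dimension as \<open>D(\<phi>\<^sub>E) = D(\<phi>)\<close>, which is that of
  \<open>D(\<psi>)\<close>. As \<open>D(\<psi>) \<subseteq> D(\<psi>\<^sub>E)\<close>, the two coincide, so \<open>D(\<psi>)\<close> is preserved by \<open>r\<^sup>p = x\<close>
  (\<open>scaled_values_transfer\<close>), and \<open>x\<close> is a similarity factor of \<open>\<psi>\<close>. The roles of the forms are symmetric.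

  What remains is to know that scalar extension behaves as it should: it is a finite-dimensional
  vector space whose dimension depends only on that of \<open>V\<close>, and the extended form exists and is unique. Both
  follow from the universal property of the tensor product (\<open>extension_universal\<close>) and from the fact that
  pure tensors generate it additively (\<open>extension_induct\<close>).
\<close>

section \<open>Linear maps between finite-dimensional spaces\<close>

lemma linear_mapI:
  assumes "vectorspace K V" "vectorspace K W" "f \<in> carrier V \<rightarrow> carrier W"
    and "\<And>v w. v \<in> carrier V \<Longrightarrow> w \<in> carrier V \<Longrightarrow> f (v \<oplus>\<^bsub>V\<^esub> w) = f v \<oplus>\<^bsub>W\<^esub> f w"
    and "\<And>c v. c \<in> carrier K \<Longrightarrow> v \<in> carrier V \<Longrightarrow> f (c \<odot>\<^bsub>V\<^esub> v) = c \<odot>\<^bsub>W\<^esub> f v"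
  shows "linear_map K V W f"
  using assms
  by (simp add: linear_map_def mod_hom_def mod_hom_axioms_def module_hom_def vectorspace_def)

lemma linear_mapD:
  assumes "linear_map K V W f"
  shows "vectorspace K V" "vectorspace K W"
    "\<And>v. v \<in> carrier V \<Longrightarrow> f v \<in> carrier W"
    "\<And>v w. v \<in> carrier V \<Longrightarrow> w \<in> carrier V \<Longrightarrow> f (v \<oplus>\<^bsub>V\<^esub> w) = f v \<oplus>\<^bsub>W\<^esub> f w"
    "\<And>c v. c \<in> carrier K \<Longrightarrow> v \<in> carrier V \<Longrightarrow> f (c \<odot>\<^bsub>V\<^esub> v) = c \<odot>\<^bsub>W\<^esub> f v"
    "f \<zero>\<^bsub>V\<^esub> = \<zero>\<^bsub>W\<^esub>"
proof -
  interpret linear_map K V W f by fact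
  show "vectorspace K V" "vectorspace K W" by unfold_locales
  show "\<And>v. v \<in> carrier V \<Longrightarrow> f v \<in> carrier W"
    "\<And>v w. v \<in> carrier V \<Longrightarrow> w \<in> carrier V \<Longrightarrow> f (v \<oplus>\<^bsub>V\<^esub> w) = f v \<oplus>\<^bsub>W\<^esub> f w"
    "\<And>c v. c \<in> carrier K \<Longrightarrow> v \<in> carrier V \<Longrightarrow> f (c \<odot>\<^bsub>V\<^esub> v) = c \<odot>\<^bsub>W\<^esub> f v"
    "f \<zero>\<^bsub>V\<^esub> = \<zero>\<^bsub>W\<^esub>"
    by auto
qed

lemma linear_map_comp:
  assumes "linear_map K U V f" "linear_map K V W g"
  shows "linear_map K U W (g \<circ> f)"
  using linear_mapD[OF assms(1)] linear_mapD[OF assms(2)] by (intro linear_mapI) auto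

lemma linear_map_inv:
  assumes f: "linear_map K V W f" and bij: "bij_betw f (carrier V) (carrier W)"
  shows "linear_map K W V (inv_into (carrier V) f)"
proof -
  let ?g = "inv_into (carrier V) f"
  note fD = linear_mapD[OF f]
  interpret V: vectorspace K V by (rule fD(1))
  have g: "?g w \<in> carrier V" "f (?g w) = w" if "w \<in> carrier W" for w
    using bij that by (auto simp: bij_betw_def inv_into_into f_inv_into_f)
  have inj: "inj_on f (carrier V)" using bij by (auto simp: bij_betw_def)
  show ?thesis
  proof (rule linear_mapI[OF fD(2,1)])
    fix v w assume vw: "v \<in> carrier W" "w \<in> carrier W"
    have "?g (f (?g v \<oplus>\<^bsub>V\<^esub> ?g w)) = ?g v \<oplus>\<^bsub>V\<^esub> ?g w"
      using g vw by (intro inv_into_f_f inj) auto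
    then show "?g (v \<oplus>\<^bsub>W\<^esub> w) = ?g v \<oplus>\<^bsub>V\<^esub> ?g w" using g vw fD(4) by simp
  next
    fix c w assume cw: "c \<in> carrier K" "w \<in> carrier W"
    have "?g (f (c \<odot>\<^bsub>V\<^esub> ?g w)) = c \<odot>\<^bsub>V\<^esub> ?g w"
      using g cw by (intro inv_into_f_f inj) auto
    then show "?g (c \<odot>\<^bsub>W\<^esub> w) = c \<odot>\<^bsub>V\<^esub> ?g w" using g cw fD(5) by simp
  qed (use g in auto)
qed

lemma (in vectorspace) coordinates_bij:
  assumes "finite B" "basis B"
  shows "linear_map K (func_space B) V (\<lambda>a. lincomb a B)"
    and "bij_betw (\<lambda>a. lincomb a B) (carrier (func_space B)) (carrier V)"
proof -
  have B: "B \<subseteq> carrier V" using assms(2) by (simp add: basis_def)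
  show "linear_map K (func_space B) V (\<lambda>a. lincomb a B)"
    by (rule lincomb_is_linear[OF assms(1) B])
  have ex1: "\<exists>!a. a \<in> B \<rightarrow>\<^sub>E carrier K \<and> lincomb a B = v" if "v \<in> carrier V" for v
    using assms(2) that unfolding basis_criterion[OF assms(1) B] by blast
  have cl: "lincomb a B \<in> carrier V" if "a \<in> B \<rightarrow>\<^sub>E carrier K" for a
    using that B by (intro lincomb_closed) auto
  show "bij_betw (\<lambda>a. lincomb a B) (carrier (func_space B)) (carrier V)"
    unfolding bij_betw_def func_space_def partial_object.simps
  proof
    show "inj_on (\<lambda>a. lincomb a B) (B \<rightarrow>\<^sub>E carrier K)"
      using ex1 cl by (metis (no_types, lifting) inj_onI)
    show "(\<lambda>a. lincomb a B) ` (B \<rightarrow>\<^sub>E carrier K) = carrier V"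
      using ex1 cl by (auto simp: image_iff) metis
  qed
qed

lemma (in vectorspace) func_space_reindex:
  assumes h: "bij_betw h B C"
  shows "linear_map K (func_space C) (func_space B) (\<lambda>a. \<lambda>b\<in>B. a (h b))"
    and "bij_betw (\<lambda>a. \<lambda>b\<in>B. a (h b)) (carrier (func_space C)) (carrier (func_space B))"
proof -
  have hB: "h b \<in> C" if "b \<in> B" for b using h that by (auto simp: bij_betw_def)
  have hi: "inv_into B h c \<in> B" "h (inv_into B h c) = c" if "c \<in> C" for c
    using h that by (auto simp: bij_betw_def inv_into_into f_inv_into_f)
  have ih: "inv_into B h (h b) = b" if "b \<in> B" for b
    using h that by (auto simp: bij_betw_def)
  show "linear_map K (func_space C) (func_space B) (\<lambda>a. \<lambda>b\<in>B. a (h b))"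
    by (rule linear_mapI[OF func_space_is_vs func_space_is_vs])
      (use hB in \<open>auto simp: func_space_def restrict_def PiE_def Pi_def extensional_def\<close>)
  show "bij_betw (\<lambda>a. \<lambda>b\<in>B. a (h b)) (carrier (func_space C)) (carrier (func_space B))"
    unfolding func_space_def partial_object.simps
    by (rule bij_betw_byWitness[where f' = "\<lambda>a. \<lambda>c\<in>C. a (inv_into B h c)"])
      (use hB hi ih in \<open>auto simp: restrict_def PiE_def Pi_def extensional_def fun_eq_iff\<close>)
qed

text \<open>Coordinates with respect to bases identify both spaces with spaces of functions on their bases,
  and bases of the same cardinality can be matched.\<close>

lemma equal_dim_imp_linear_bij:
  assumes V: "vectorspace K V" "vectorspace.fin_dim K V"
    and W: "vectorspace K W" "vectorspace.fin_dim K W"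
    and dim: "vectorspace.dim K V = vectorspace.dim K W"
  obtains f where "linear_map K V W f" "bij_betw f (carrier V) (carrier W)"
proof -
  interpret V: vectorspace K V by fact
  interpret W: vectorspace K W by fact
  obtain B where B: "finite B" "V.basis B" using V.finite_basis_exists[OF V(2)] by blast
  obtain C where C: "finite C" "W.basis C" using W.finite_basis_exists[OF W(2)] by blast
  have "card C = card B" using dim V.dim_basis[OF B] W.dim_basis[OF C] by simp
  then obtain h where h: "bij_betw h C B"
    using B(1) C(1) finite_same_card_bij by blast
  note lV = V.coordinates_bij[OF B] and lW = W.coordinates_bij[OF C]
    and r = V.func_space_reindex[OF h]
  note iV = linear_map_inv[OF lV] bij_betw_inv_into[OF lV(2)]
  show ?thesis
    using linear_map_comp[OF linear_map_comp[OF iV(1) r(1)] lW(1)]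
      bij_betw_trans[OF bij_betw_trans[OF iV(2) r(2)] lW(2)] that by blast
qed

text \<open>The image of a basis is linearly independent and has as many elements as the dimension of the
  target, so it is a basis there.\<close>

lemma linear_inj_equal_dim_imp_surj:
  assumes f: "linear_map K V W f" and inj: "inj_on f (carrier V)"
    and V: "vectorspace.fin_dim K V" and W: "vectorspace.fin_dim K W"
    and dim: "vectorspace.dim K V = vectorspace.dim K W"
  shows "f ` carrier V = carrier W"
proof -
  note fD = linear_mapD[OF f]
  interpret V: vectorspace K V by (rule fD(1))
  interpret W: vectorspace K W by (rule fD(2))
  obtain B where B: "finite B" "V.basis B" using V.finite_basis_exists[OF V] by blast
  have Bc: "B \<subseteq> carrier V" using B(2) by (simp add: V.basis_def)
  have injB: "inj_on f B" using inj Bc by (rule inj_on_subset)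
  have fB: "f ` B \<subseteq> carrier W" using Bc fD(3) by auto
  have "W.basis (f ` B)"
  proof (rule W.dim_li_is_basis[OF W _ fB])
    show "\<not> W.lin_dep (f ` B)"
    proof (rule W.finite_lin_indpt2[OF _ fB])
      fix a assume a: "a \<in> f ` B \<rightarrow> carrier K" "W.lincomb a (f ` B) = \<zero>\<^bsub>W\<^esub>"
      have "f (V.lincomb (a \<circ> f) B) = f \<zero>\<^bsub>V\<^esub>"
        using linear_map.lincomb_linear_image[OF f inj Bc a(1) B(1)] a(2) fD(6) by simp
      moreover have "V.lincomb (a \<circ> f) B \<in> carrier V"
        using Bc a(1) by (intro V.lincomb_closed) auto
      ultimately have "V.lincomb (a \<circ> f) B = \<zero>\<^bsub>V\<^esub>"
        using inj by (meson V.M.zero_closed inj_onD)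
      then have "(a \<circ> f) \<in> B \<rightarrow> {\<zero>\<^bsub>K\<^esub>}"
        using B a(1) by (intro V.not_lindepD[of B B]) (auto simp: V.basis_def)
      then show "\<forall>v\<in>f ` B. a v = \<zero>\<^bsub>K\<^esub>" by auto
    qed (use B in auto)
    show "card (f ` B) \<ge> W.dim"
      using card_image[OF injB] V.dim_basis[OF B] dim by simp
  qed (use B in auto)
  then have "W.span (f ` B) = carrier W" by (simp add: W.basis_def)
  moreover have "submodule K (f ` carrier V) W"
    using linear_map.imT_is_subspace[OF f] linear_map.axioms(3)[OF f]
    by (simp add: subspace_def mod_hom.im_def)
  then have "W.span (f ` B) \<subseteq> f ` carrier V"
    by (intro W.span_is_subset) (use Bc in auto)
  moreover have "f ` carrier V \<subseteq> carrier W" using fD(3) by auto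
  ultimately show ?thesis by auto
qed

text \<open>Independent subsets of the subspace are bounded in size by the dimension of the whole space, so a
  maximal one exists and is a basis.\<close>

lemma (in vectorspace) subspace_fin_dim:
  assumes fd: fin_dim and N: "subspace K N V"
  shows "vectorspace.fin_dim K (vs N)"
proof -
  interpret N: vectorspace K "vs N" by (rule subspace_is_vs[OF N])
  have sub: "submodule K N V" using N by simp
  have Nc: "N \<subseteq> carrier V" using sub by (simp add: submodule_def)
  have "\<exists>A. finite A \<and> maximal A (\<lambda>S. S \<subseteq> N \<and> lin_indpt S)"
  proof (rule maximal_exists[where B = "{}" and N = dim])
    show "finite A \<and> card A \<le> dim" if "A \<subseteq> N \<and> lin_indpt A" for A
      using li_le_dim[OF fd, of A] that Nc by auto
  qed (auto simp: lin_dep_def)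
  then obtain A where A: "finite A" "maximal A (\<lambda>S. S \<subseteq> N \<and> lin_indpt S)" by blast
  have "maximal A (\<lambda>S. S \<subseteq> carrier (vs N) \<and> N.lin_indpt S)"
    using A(2) span_li_not_depend(2)[OF _ sub] by (auto simp: maximal_def)
  then have "N.basis A" by (rule N.max_li_is_basis)
  then show ?thesis using A(1) by (auto simp: N.fin_dim_def N.basis_def)
qed

text \<open>A basis of the subspace extends to one of the whole space; the added vectors span a complement.\<close>

lemma (in vectorspace) complement_exists:
  assumes fd: fin_dim and N: "subspace K N V"
  obtains M where "subspace K M V"
    and "bij_betw (\<lambda>v. fst v \<oplus>\<^bsub>V\<^esub> snd v) (carrier (direct_sum (vs M) (vs N))) (carrier V)"
proof -
  interpret N: vectorspace K "vs N" by (rule subspace_is_vs[OF N])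
  have sub: "submodule K N V" using N by simp
  have Nc: "N \<subseteq> carrier V" using sub by (simp add: submodule_def)
  obtain A where A: "finite A" "N.basis A"
    using N.finite_basis_exists[OF subspace_fin_dim[OF fd N]] by blast
  have AN: "A \<subseteq> N" and Ac: "A \<subseteq> carrier V" using A(2) Nc by (auto simp: N.basis_def)
  have spanA: "span A = N" and liA: "lin_indpt A"
    using A(2) span_li_not_depend[OF AN sub] by (auto simp: N.basis_def)
  obtain B where B: "finite B" "basis B" using finite_basis_exists[OF fd] by blast
  have Bc: "B \<subseteq> carrier V" and spanB: "span B = carrier V" using B(2) by (auto simp: basis_def)
  obtain C where C: "finite C" "C \<subseteq> carrier V" "C \<inter> A = {}"
    "int (card C) \<le> int (card B) - int (card A)" "span (A \<union> C) = carrier V"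
    using replacement[OF A(1) B(1) Bc liA] Ac spanB by metis
  have "card (A \<union> C) \<le> dim"
    using C(4) dim_basis[OF B] card_Un_le[of A C] by linarith
  \<comment> \<open>The exchange bound on the size of \<open>C\<close> makes the generating set \<open>A \<union> C\<close> as small as a basis.\<close>
  then have "basis (A \<union> C)" using A(1) C Ac by (intro dim_gen_is_basis) auto
  then have li: "lin_indpt (C \<union> A)" by (simp add: basis_def Un_commute)
  define M where "M = span C"
  have M: "subspace K M V" unfolding M_def by (rule span_is_subspace[OF C(2)])
  let ?s = "\<lambda>v. fst v \<oplus>\<^bsub>V\<^esub> snd v"
  note lin = sum_map_linear[OF M N]
  have "inj_on ?s (carrier (direct_sum (vs M) (vs N)))"
  proof (rule linear_map.Ke0_imp_inj[OF lin])
    have "v = \<zero>\<^bsub>V\<^esub> \<and> w = \<zero>\<^bsub>V\<^esub>" if vw: "v \<in> M" "w \<in> N" "v \<oplus>\<^bsub>V\<^esub> w = \<zero>\<^bsub>V\<^esub>" for v w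
    proof -
      obtain c where c: "c \<in> C \<rightarrow> carrier K" "lincomb c C = v"
        using finite_in_span[OF C(1,2)] vw(1) by (auto simp: M_def)
      obtain a where a: "a \<in> A \<rightarrow> carrier K" "lincomb a A = w"
        using finite_in_span[OF A(1) Ac] vw(2) by (auto simp: spanA)
      let ?d = "\<lambda>v. if v \<in> C then c v else a v"
      have "lincomb ?d (C \<union> A) = \<zero>\<^bsub>V\<^esub>"
        using lincomb_union2[of C A c a] A(1) C Ac a c vw(3) by simp
      then have "?d \<in> C \<union> A \<rightarrow> {\<zero>\<^bsub>K\<^esub>}"
        using A(1) C a c by (intro not_lindepD[OF li]) auto
      then have d: "?d x = \<zero>\<^bsub>K\<^esub>" if "x \<in> C \<union> A" for x using that by blast
      have "c \<in> C \<rightarrow> {\<zero>\<^bsub>K\<^esub>}" using d by fastforce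
      moreover have "x \<notin> C" if "x \<in> A" for x using that C(3) by blast
      then have "a \<in> A \<rightarrow> {\<zero>\<^bsub>K\<^esub>}" using d by fastforce
      ultimately show ?thesis using lincomb_zero[OF C(2)] lincomb_zero[OF Ac] a c by auto
    qed
    moreover have "\<zero>\<^bsub>V\<^esub> \<in> M" "\<zero>\<^bsub>V\<^esub> \<in> N"
      using M N by (auto simp: subspace_def submodule.zero_closed)
    ultimately show "carrier (direct_sum (vs M) (vs N)
        \<lparr>carrier := mod_hom.ker (direct_sum (vs M) (vs N)) V ?s\<rparr>) =
      {\<zero>\<^bsub>direct_sum (vs M) (vs N)\<^esub>}"
      using linear_map.axioms(3)[OF lin]
      by (auto simp: mod_hom.ker_def direct_sum_def)
  qed
  moreover have "?s ` carrier (direct_sum (vs M) (vs N)) = carrier V"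
  proof -
    have "{(v, w). v \<in> M \<and> w \<in> N} = carrier (direct_sum (vs M) (vs N))"
      by (auto simp: direct_sum_def)
    then show ?thesis
      using span_union_is_sum[OF C(2) Ac] C(5)
      by (simp add: Un_commute submodule_sum_def M_def spanA case_prod_beta')
  qed
  ultimately show ?thesis using that[OF M] by (simp add: bij_betw_def)
qed

text \<open>The maps \<open>i\<close> and \<open>j\<close> identify two spaces of equal dimension with sets of values. As soon as addition
  and scalars act on both sets by the same rule, one set cannot be properly contained in the other.
  For quasilinear forms the values lie in an extension field and a scalar \<open>c\<close> acts by multiplication
  with the image of \<open>c\<^sup>p\<close>. Taking \<open>ad\<close> and \<open>act\<close> to be arbitrary functions avoids turning a value set
  into a vector space for this twisted action.\<close>

lemma semilinear_factorization:
  assumes V: "vectorspace F V" "vectorspace.fin_dim F V"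
    and W: "vectorspace F W" "vectorspace.fin_dim F W"
    and dim: "vectorspace.dim F V = vectorspace.dim F W"
    and i_add: "\<And>v v'. v \<in> carrier V \<Longrightarrow> v' \<in> carrier V \<Longrightarrow> i (v \<oplus>\<^bsub>V\<^esub> v') = ad (i v) (i v')"
    and i_act: "\<And>c v. c \<in> carrier F \<Longrightarrow> v \<in> carrier V \<Longrightarrow> i (c \<odot>\<^bsub>V\<^esub> v) = act c (i v)"
    and i_inj: "inj_on i (carrier V)"
    and j_add: "\<And>w w'. w \<in> carrier W \<Longrightarrow> w' \<in> carrier W \<Longrightarrow> j (w \<oplus>\<^bsub>W\<^esub> w') = ad (j w) (j w')"
    and j_act: "\<And>c w. c \<in> carrier F \<Longrightarrow> w \<in> carrier W \<Longrightarrow> j (c \<odot>\<^bsub>W\<^esub> w) = act c (j w)"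
    and j_inj: "inj_on j (carrier W)"
    and sub: "i ` carrier V \<subseteq> j ` carrier W"
  obtains g where "linear_map F V W g" "bij_betw g (carrier V) (carrier W)"
    "\<And>v. v \<in> carrier V \<Longrightarrow> j (g v) = i v" "i ` carrier V = j ` carrier W"
proof -
  interpret V: vectorspace F V by fact
  interpret W: vectorspace F W by fact
  define g where "g v = inv_into (carrier W) j (i v)" for v
  have g: "g v \<in> carrier W" "j (g v) = i v" if "v \<in> carrier V" for v
  proof -
    have "i v \<in> j ` carrier W" using sub that by blast
    then show "g v \<in> carrier W" "j (g v) = i v"
      unfolding g_def by (rule inv_into_into, rule f_inv_into_f)
  qed
  have lin: "linear_map F V W g"
  proof (rule linear_mapI[OF V(1) W(1)])
    fix v w assume vw: "v \<in> carrier V" "w \<in> carrier V"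
    show "g (v \<oplus>\<^bsub>V\<^esub> w) = g v \<oplus>\<^bsub>W\<^esub> g w"
      by (rule inj_onD[OF j_inj]) (use vw g i_add j_add in simp_all)
  next
    fix c v assume cv: "c \<in> carrier F" "v \<in> carrier V"
    show "g (c \<odot>\<^bsub>V\<^esub> v) = c \<odot>\<^bsub>W\<^esub> g v"
      by (rule inj_onD[OF j_inj]) (use cv g i_act j_act in simp_all)
  qed (use g in auto)
  have inj: "inj_on g (carrier V)"
    by (rule inj_onI) (metis g(2) i_inj inj_onD)
  have surj: "g ` carrier V = carrier W"
    by (rule linear_inj_equal_dim_imp_surj[OF lin inj V(2) W(2) dim])
  have "i ` carrier V = (\<lambda>v. j (g v)) ` carrier V" using g(2) by (intro image_cong) auto
  also have "\<dots> = j ` carrier W" using surj by (metis image_image)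
  finally show ?thesis using that[OF lin _ g(2)] inj surj by (simp add: bij_betw_def)
qed

section \<open>Characteristic p and p-th roots\<close>

lemma (in cring) binomial_theorem:
  assumes a: "a \<in> carrier R" and b: "b \<in> carrier R"
  shows "(a \<oplus> b) [^] n = (\<Oplus>k\<in>{..n}. [(n choose k)] \<cdot> (a [^] k \<otimes> b [^] (n - k)))"
proof (induction n)
  case 0
  then show ?case using a b by simp
next
  case (Suc n)
  let ?t = "\<lambda>n k. [(n choose k)] \<cdot> (a [^] k \<otimes> b [^] (n - k))"
  let ?u = "\<lambda>k. [(n choose k)] \<cdot> (a [^] Suc k \<otimes> b [^] (n - k))"
  let ?w = "\<lambda>k. [(n choose k)] \<cdot> (a [^] k \<otimes> b [^] (Suc n - k))"
  have cl: "?t n k \<in> carrier R" "?u k \<in> carrier R" "?w k \<in> carrier R" for n k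
    using a b by auto
  have A: "finsum R (?t n) {..n} \<otimes> a = finsum R ?u {..n}"
  proof -
    have "finsum R (?t n) {..n} \<otimes> a = (\<Oplus>k\<in>{..n}. ?t n k \<otimes> a)"
      using a cl by (intro finsum_ldistr) auto
    also have "\<dots> = finsum R ?u {..n}"
      using a b by (intro finsum_cong') (auto simp: add_pow_ldistr add_pow_rdistr m_ac)
    finally show ?thesis .
  qed
  have B: "finsum R (?t n) {..n} \<otimes> b = finsum R ?w {..n}"
  proof -
    have "finsum R (?t n) {..n} \<otimes> b = (\<Oplus>k\<in>{..n}. ?t n k \<otimes> b)"
      using b cl by (intro finsum_ldistr) auto
    also have "\<dots> = finsum R ?w {..n}"
      using a b by (intro finsum_cong') (auto simp: add_pow_ldistr add_pow_rdistr m_ac Suc_diff_le)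
    finally show ?thesis .
  qed
  \<comment> \<open>The summand of index \<open>Suc n\<close> in the second sum vanishes, so Pascal's rule applies termwise.\<close>
  have W: "finsum R ?w {..n} = (\<Oplus>k\<in>{..n}. ?w (Suc k)) \<oplus> ?w 0"
  proof -
    have "finsum R ?w {..Suc n} = ?w (Suc n) \<oplus> finsum R ?w {..n}"
      using cl by (intro finsum_Suc) auto
    also have "\<dots> = finsum R ?w {..n}"
      using cl by (simp add: binomial_eq_0)
    finally show ?thesis using cl by (subst (asm) finsum_Suc2) auto
  qed
  have fs: "finsum R ?u {..n} \<in> carrier R" "(\<Oplus>k\<in>{..n}. ?w (Suc k)) \<in> carrier R"
      "?w 0 \<in> carrier R"
    using a b by (auto intro!: finsum_closed)
  have "finsum R (?t (Suc n)) {..Suc n} = (\<Oplus>k\<in>{..n}. ?t (Suc n) (Suc k)) \<oplus> ?t (Suc n) 0"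
    using cl by (intro finsum_Suc2) auto
  also have "(\<Oplus>k\<in>{..n}. ?t (Suc n) (Suc k)) = (\<Oplus>k\<in>{..n}. ?u k \<oplus> ?w (Suc k))"
    using a b by (intro finsum_cong') (auto simp: add.nat_pow_mult)
  also have "\<dots> = finsum R ?u {..n} \<oplus> (\<Oplus>k\<in>{..n}. ?w (Suc k))"
    using a b by (intro finsum_addf) auto
  also have "?t (Suc n) 0 = ?w 0" by simp
  finally have pascal: "finsum R (?t (Suc n)) {..Suc n} = finsum R ?u {..n} \<oplus> finsum R ?w {..n}"
    using a_assoc[OF fs] by (simp only: W)
  then show ?case
  proof -
    have "finsum R (?t n) {..n} \<in> carrier R" using a b by (auto intro!: finsum_closed)
    then have "(a \<oplus> b) [^] Suc n = finsum R (?t n) {..n} \<otimes> a \<oplus> finsum R (?t n) {..n} \<otimes> b"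
      using Suc a b by (simp add: r_distr)
    then show ?thesis using pascal by (simp only: A B)
  qed
qed

text \<open>The prime \<open>p\<close> divides all binomial coefficients except the first and the last one.\<close>

lemma (in cring) frobenius_add:
  fixes p :: nat
  assumes p: "prime p" and char: "[p] \<cdot> \<one> = \<zero>"
    and a: "a \<in> carrier R" and b: "b \<in> carrier R"
  shows "(a \<oplus> b) [^] p = a [^] p \<oplus> b [^] p"
proof -
  let ?t = "\<lambda>k. [(p choose k)] \<cdot> (a [^] k \<otimes> b [^] (p - k))"
  have cl: "?t k \<in> carrier R" for k using a b by auto
  have zero: "?t k = \<zero>" if k: "k \<in> {1..p - 1}" for k
  proof -
    have "p dvd (p choose k)" using p k prime_gt_0_nat[OF p] by (intro dvd_choose_prime) auto
    then obtain m where m: "(p choose k) = p * m" by blast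
    have "[(p * m)] \<cdot> x = \<zero>" if x: "x \<in> carrier R" for x
    proof -
      have "[p] \<cdot> x = ([p] \<cdot> \<one>) \<otimes> x" using x by (simp add: add_pow_ldistr)
      then have "[p] \<cdot> x = \<zero>" using char x by simp
      then show ?thesis using x by (metis add.nat_pow_pow add.nat_pow_one)
    qed
    then show ?thesis using a b by (simp add: m)
  qed
  \<comment> \<open>As \<open>p \<ge> 2\<close>, the first and the last summand can be split off.\<close>
  obtain q where q: "p = Suc (Suc q)"
    using prime_ge_2_nat[OF p] by (metis Suc_diff_Suc add_2_eq_Suc le_add_diff_inverse)
  have "(a \<oplus> b) [^] p = finsum R ?t {..p}" by (rule binomial_theorem[OF a b])
  also have "\<dots> = ?t p \<oplus> (finsum R (\<lambda>k. ?t (Suc k)) {..q} \<oplus> ?t 0)"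
    unfolding q by (subst finsum_Suc, use cl[unfolded q] in blast, subst finsum_Suc2) (use cl[unfolded q] in blast)+
  also have "finsum R (\<lambda>k. ?t (Suc k)) {..q} = \<zero>"
    by (rule add.finprod_one_eqI) (rule zero, auto simp: q)
  also have "?t p \<oplus> (\<zero> \<oplus> ?t 0) = a [^] p \<oplus> b [^] p" using a b by simp
  finally show ?thesis .
qed

lemma (in ring) has_characteristic_add_pow:
  assumes "has_characteristic R p"
  shows "[p] \<cdot> \<one> = \<zero>"
  using group.pow_eq_id[OF comm_group.axioms(2)[OF a_comm_group], of \<one> p] assms
  by (simp add: has_characteristic_def add_pow_def)

text \<open>The additive order of \<open>\<one>\<close> in the target divides the prime \<open>p\<close>, and it differs from \<open>1\<close> since \<open>\<one> \<noteq> \<zero>\<close>.\<close>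

lemma has_characteristic_hom:
  assumes F: "field F" and E: "field E" and \<iota>: "\<iota> \<in> ring_hom F E"
    and p: "prime p" and char: "has_characteristic F p"
  shows "has_characteristic E p"
proof -
  interpret F: field F by fact
  interpret E: field E by fact
  interpret \<iota>: ring_hom_ring F E \<iota> by (rule ring_hom_ringI2[OF F.ring_axioms E.ring_axioms \<iota>])
  have gF: "group (add_monoid F)" and gE: "group (add_monoid E)"
    using F.a_comm_group E.a_comm_group by (simp_all add: comm_group.axioms(2))
  have "pow (add_monoid F) \<one>\<^bsub>F\<^esub> p = \<zero>\<^bsub>F\<^esub>"
    using group.pow_eq_id[OF gF, of "\<one>\<^bsub>F\<^esub>" p] char by (simp add: has_characteristic_def)
  moreover have "\<iota> \<in> hom (add_monoid F) (add_monoid E)"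
    by (simp add: hom_def)
  ultimately have "pow (add_monoid E) \<one>\<^bsub>E\<^esub> p = \<zero>\<^bsub>E\<^esub>"
    using Group.hom_nat_pow[of \<iota> "add_monoid F" "add_monoid E" "\<one>\<^bsub>F\<^esub>" p] gF gE by simp
  then have "group.ord (add_monoid E) \<one>\<^bsub>E\<^esub> dvd p"
    using group.pow_eq_id[OF gE, of "\<one>\<^bsub>E\<^esub>" p] by simp
  moreover have "group.ord (add_monoid E) \<one>\<^bsub>E\<^esub> \<noteq> 1"
    using group.ord_eq_1[OF gE, of "\<one>\<^bsub>E\<^esub>"] E.one_not_zero by simp
  ultimately show ?thesis
    using p by (auto simp: has_characteristic_def prime_nat_iff)
qed

lemma (in domain) nat_pow_nonzero:
  assumes "x \<in> carrier R" "x \<noteq> \<zero>"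
  shows "x [^] (n :: nat) \<noteq> \<zero>"
  using assms by (induction n) (simp_all add: integral_iff)

text \<open>The \<open>p\<close>-th power of \<open>b \<ominus> c\<close> is \<open>b\<^sup>p \<ominus> c\<^sup>p = \<zero>\<close>.\<close>

lemma (in field) frobenius_inj:
  fixes p :: nat
  assumes p: "prime p" and char: "[p] \<cdot> \<one> = \<zero>"
    and b: "b \<in> carrier R" and c: "c \<in> carrier R" and eq: "b [^] p = c [^] p"
  shows "b = c"
proof -
  have "b = (b \<ominus> c) \<oplus> c" using b c by (simp add: a_minus_def a_assoc l_neg)
  then have "b [^] p = (b \<ominus> c) [^] p \<oplus> c [^] p"
    using frobenius_add[OF p char, of "b \<ominus> c" c] b c by simp
  then have "(b \<ominus> c) [^] p = \<zero>" using b c eq by (metis minus_closed nat_pow_closed add.r_cancel_one)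
  then have "b \<ominus> c = \<zero>"
    using b c by (metis minus_closed nat_pow_nonzero)
  then show ?thesis using b c by simp
qed

lemma (in algebraically_closed) nth_root_exists:
  assumes a: "a \<in> carrier L" and n: "0 < (n::nat)"
  obtains b where "b \<in> carrier L" "b [^] n = a"
proof -
  obtain m where m: "n = Suc m" using n by (metis gr0_implies_Suc)
  \<comment> \<open>The coefficients of \<open>X\<^sup>n \<ominus> a\<close>, the leading one first.\<close>
  define P where "P = \<one> # replicate m \<zero> @ [\<ominus> a]"
  have P: "P \<in> carrier (poly_ring L)"
    using a unfolding univ_poly_carrier[symmetric] polynomial_def P_def by auto
  have "size (roots P) = n"
    using roots_over_carrier[OF P] by (simp add: splitted_def P_def m)
  then obtain b where "b \<in># roots P" using n by (metis multiset_nonemptyE nat_less_le size_empty)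
  then have b: "b \<in> carrier L" "eval P b = \<zero>"
    using roots_mem_iff_is_root[OF P] by (auto simp: is_root_def)
  have "b [^] n \<oplus> \<ominus> a = \<zero>"
    using b a by (simp add: P_def m eval_replicate)
  then have "b [^] n = a" using minus_equality[of "b [^] n" "\<ominus> a"] b(1) a by simp
  then show ?thesis using that b(1) by blast
qed

text \<open>A root of \<open>X\<^sup>p \<ominus> a\<close> exists in the algebraic closure, and injectivity of the Frobenius map makes the
  definite description meaningful.\<close>

lemma pth_root_properties:
  assumes F: "field F" and p: "prime p" and char: "has_characteristic F p" and a: "a \<in> carrier F"
  shows "pth_root p F a \<in> carrier (field.alg_closure F)"
    and "pth_root p F a [^]\<^bsub>field.alg_closure F\<^esub> p = closure_embedding F a"
proof -
  interpret F: field F by fact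
  let ?L = "F.alg_closure"
  interpret L: algebraic_closure ?L "closure_embedding F ` carrier F" by (rule F.alg_closureE(1))
  have L: "field ?L" by (rule L.field_axioms)
  note hom = F.alg_closureE(2)
  have charL: "[p] \<cdot>\<^bsub>?L\<^esub> \<one>\<^bsub>?L\<^esub> = \<zero>\<^bsub>?L\<^esub>"
    by (rule L.has_characteristic_add_pow[OF has_characteristic_hom[OF F L hom p char]])
  have "closure_embedding F a \<in> carrier ?L" by (rule ring_hom_closed[OF hom a])
  then obtain b where "b \<in> carrier ?L" "b [^]\<^bsub>?L\<^esub> p = closure_embedding F a"
    using L.nth_root_exists[of _ p] prime_gt_0_nat[OF p] by metis
  then have "\<exists>!b. b \<in> carrier ?L \<and> b [^]\<^bsub>?L\<^esub> p = closure_embedding F a"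
    using L.frobenius_inj[OF p charL] by metis
  then have "pth_root p F a \<in> carrier ?L \<and> pth_root p F a [^]\<^bsub>?L\<^esub> p = closure_embedding F a"
    unfolding pth_root_def by (rule theI')
  then show "pth_root p F a \<in> carrier ?L" "pth_root p F a [^]\<^bsub>?L\<^esub> p = closure_embedding F a"
    by simp_all
qed

section \<open>Anisotropic part and defect\<close>

context quasilinear_form
begin

lemma form_zero: "\<phi> \<zero>\<^bsub>V\<^esub> = \<zero>\<^bsub>F\<^esub>"
proof -
  have "\<phi> \<zero>\<^bsub>V\<^esub> \<in> carrier F" using form_closed by auto
  moreover have "\<phi> \<zero>\<^bsub>V\<^esub> \<oplus>\<^bsub>F\<^esub> \<phi> \<zero>\<^bsub>V\<^esub> = \<phi> \<zero>\<^bsub>V\<^esub>"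
    using form_add[of "\<zero>\<^bsub>V\<^esub>" "\<zero>\<^bsub>V\<^esub>"] by simp
  ultimately show ?thesis by (metis R.add.l_cancel_one')
qed

definition null_space :: "'v set" where
  "null_space = {v \<in> carrier V. \<phi> v = \<zero>\<^bsub>F\<^esub>}"

lemma null_space_subspace: "subspace F null_space V"
  unfolding subspace_def
proof
  show "vectorspace F V" by unfold_locales
  show "submodule F null_space V"
    by (rule submodule.intro) (auto simp: null_space_def form_zero form_add form_smult module_axioms)
qed

text \<open>Two vectors with the same value differ by a zero of the form, because the form is additive.\<close>

lemma anisotropic_imp_inj:
  assumes "anisotropic F V \<phi>"
  shows "inj_on \<phi> (carrier V)"
proof (rule inj_onI)
  fix v w assume vw: "v \<in> carrier V" "w \<in> carrier V" "\<phi> v = \<phi> w"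
  have v: "(v \<ominus>\<^bsub>V\<^esub> w) \<oplus>\<^bsub>V\<^esub> w = v" using vw by (simp add: M.minus_eq M.a_assoc M.l_neg)
  have "\<phi> (v \<ominus>\<^bsub>V\<^esub> w) \<oplus>\<^bsub>F\<^esub> \<phi> w = \<phi> w"
    using form_add[of "v \<ominus>\<^bsub>V\<^esub> w" w] vw by (simp add: v)
  then have "\<phi> (v \<ominus>\<^bsub>V\<^esub> w) = \<zero>\<^bsub>F\<^esub>"
    using form_closed vw by (metis M.minus_closed PiE R.add.r_cancel_one)
  then have "v \<ominus>\<^bsub>V\<^esub> w = \<zero>\<^bsub>V\<^esub>"
    using assms M.minus_closed[OF vw(1,2)] unfolding isotropic_def by blast
  then show "v = w" using v vw by simp
qed

text \<open>An anisotropic form plus a zero form on \<open>U\<close> vanishes exactly on \<open>0 \<times> U\<close>. So \<open>U\<close> corresponds to the zeros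
  of \<open>\<phi>\<close>, which determines its dimension. The projection of \<open>V\<close> onto \<open>W\<close> preserves values and has
  the zeros of \<open>\<phi>\<close> as its kernel, so the dimension formula is the rank-nullity theorem for it.\<close>

lemma decomposition_properties:
  assumes W: "quasilinear_form p F W \<alpha>" "anisotropic F W \<alpha>"
    and U: "vectorspace F U"
    and iso: "isometric F V \<phi> (direct_sum W U) (orthogonal_sum F \<alpha> (\<lambda>_. \<zero>\<^bsub>F\<^esub>))"
  shows "vectorspace.dim F U = vectorspace.dim F (vs null_space)"
    and "\<exists>\<pi>. linear_map F V W \<pi> \<and> \<pi> ` carrier V = carrier W \<and>
      (\<forall>v\<in>carrier V. \<phi> v = \<alpha> (\<pi> v)) \<and>
      vectorspace.dim F W + vectorspace.dim F (vs null_space) = vectorspace.dim F V"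
proof -
  interpret W: quasilinear_form p F W \<alpha> by fact
  interpret U: vectorspace F U by fact
  have V: "vectorspace F V" by unfold_locales
  have W': "vectorspace F W" by unfold_locales
  obtain f where f: "linear_map F V (direct_sum W U) f"
    and bij: "bij_betw f (carrier V) (carrier (direct_sum W U))"
    and \<phi>: "\<And>v. v \<in> carrier V \<Longrightarrow> \<phi> v = orthogonal_sum F \<alpha> (\<lambda>_. \<zero>\<^bsub>F\<^esub>) (f v)"
    using iso by (auto simp: isometric_def)
  note fD = linear_mapD[OF f]
  have inj: "inj_on f (carrier V)" using bij by (simp add: bij_betw_def)
  have im: "f ` carrier V = carrier W \<times> carrier U"
    using bij by (simp add: bij_betw_def direct_sum_def)
  have fst: "fst (f v) \<in> carrier W" and snd: "snd (f v) \<in> carrier U" if "v \<in> carrier V" for v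
  proof -
    have "f v \<in> carrier W \<times> carrier U" using that unfolding im[symmetric] by (rule imageI)
    then show "fst (f v) \<in> carrier W" "snd (f v) \<in> carrier U" by (simp_all add: mem_Times_iff)
  qed
  define \<pi> where "\<pi> = (\<lambda>v. fst (f v))"
  have lin\<pi>: "linear_map F V W \<pi>"
    by (rule linear_mapI[OF V W']) (use fD fst in \<open>auto simp: \<pi>_def direct_sum_def\<close>)
  have im\<pi>: "\<pi> ` carrier V = carrier W"
  proof -
    have "\<pi> ` carrier V = fst ` (f ` carrier V)" by (auto simp: \<pi>_def image_image)
    then show ?thesis by (auto simp: im image_iff intro!: bexI[of _ "\<zero>\<^bsub>U\<^esub>"])
  qed
  have \<phi>\<pi>: "\<phi> v = \<alpha> (\<pi> v)" if "v \<in> carrier V" for v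
  proof -
    have "\<alpha> (fst (f v)) \<in> carrier F" using fst[OF that] W.form_closed by auto
    then show ?thesis using \<phi>[OF that] by (simp add: orthogonal_sum_def \<pi>_def case_prod_beta')
  qed
  have ker: "{v \<in> carrier V. \<pi> v = \<zero>\<^bsub>W\<^esub>} = null_space"
    using W(2) fst by (auto simp: null_space_def \<phi>\<pi> W.form_zero isotropic_def \<pi>_def)
  have "vectorspace.dim F W + vectorspace.dim F (vs null_space) = dim"
    using linear_map.rank_nullity[OF lin\<pi> finite_dimensional] im\<pi> ker
      linear_map.axioms(3)[OF lin\<pi>]
    by (simp add: mod_hom.im_def mod_hom.ker_def)
  then show "\<exists>\<pi>. linear_map F V W \<pi> \<and> \<pi> ` carrier V = carrier W \<and>
      (\<forall>v\<in>carrier V. \<phi> v = \<alpha> (\<pi> v)) \<and>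
      vectorspace.dim F W + vectorspace.dim F (vs null_space) = vectorspace.dim F V"
    using lin\<pi> im\<pi> \<phi>\<pi> by blast
  define h where "h = (\<lambda>v. snd (f v))"
  have kc: "null_space \<subseteq> carrier V" by (auto simp: null_space_def)
  have linh: "linear_map F (vs null_space) U h"
    by (rule linear_mapI[OF subspace_is_vs[OF null_space_subspace] U])
      (use fD snd kc in \<open>auto simp: h_def direct_sum_def subset_iff\<close>)
  have fk: "f v = (\<zero>\<^bsub>W\<^esub>, h v)" if "v \<in> null_space" for v
    using that ker by (auto simp: \<pi>_def h_def prod_eq_iff)
  show "vectorspace.dim F U = vectorspace.dim F (vs null_space)"
  proof (rule linear_map.dim_eq[OF linh, symmetric])
    show "vectorspace.fin_dim F (vs null_space)"
      by (rule subspace_fin_dim[OF finite_dimensional null_space_subspace])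
    show "inj_on h (carrier (vs null_space))"
      using inj kc fk by (auto simp: inj_on_def subset_iff)
    show "h ` carrier (vs null_space) = carrier U"
    proof (safe)
      fix u assume u: "u \<in> carrier U"
      then obtain v where v: "v \<in> carrier V" "f v = (\<zero>\<^bsub>W\<^esub>, u)"
        using im by (metis SigmaI W.M.zero_closed imageE)
      then have "v \<in> null_space" unfolding ker[symmetric] by (simp add: \<pi>_def)
      moreover have "h v = u" by (simp add: h_def v)
      ultimately show "u \<in> h ` carrier (vs null_space)" by auto
    next
      fix v assume "v \<in> carrier (vs null_space)"
      then show "h v \<in> carrier U" using snd kc by (auto simp: h_def)
    qed
  qed
qed

text \<open>The form restricted to a complement of its space of zeros is anisotropic, and adding a zero does
  not change a value.\<close>

lemma decomposition_exists:
  "\<exists>(W :: ('a, 'v) module) \<alpha> (U :: ('a, 'v) module).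
     quasilinear_form p F W \<alpha> \<and> anisotropic F W \<alpha> \<and>
     vectorspace F U \<and> vectorspace.fin_dim F U \<and>
     isometric F V \<phi> (direct_sum W U) (orthogonal_sum F \<alpha> (\<lambda>_. \<zero>\<^bsub>F\<^esub>))"
proof -
  obtain M where M: "subspace F M V"
    and bij: "bij_betw (\<lambda>v. fst v \<oplus>\<^bsub>V\<^esub> snd v) (carrier (direct_sum (vs M) (vs null_space))) (carrier V)"
    using complement_exists[OF finite_dimensional null_space_subspace] by blast
  let ?s = "\<lambda>v. fst v \<oplus>\<^bsub>V\<^esub> snd v" and ?D = "direct_sum (vs M) (vs null_space)"
  have sub: "submodule F M V" using M by simp
  have Mc: "M \<subseteq> carrier V" and M0: "\<zero>\<^bsub>V\<^esub> \<in> M" using sub by (auto simp: submodule_def)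
  have inj: "inj_on ?s (M \<times> null_space)" using bij by (simp add: bij_betw_def direct_sum_def)
  have M_vs: "vectorspace F (vs M)" by (rule subspace_is_vs[OF M])
  have "quasilinear_form p F (vs M) \<phi>"
    unfolding quasilinear_form_def quasilinear_form_axioms_def
    using M_vs prime characteristic subspace_fin_dim[OF finite_dimensional M] form_closed
      form_smult form_add Mc by (auto simp: subset_iff)
  moreover have "anisotropic F (vs M) \<phi>"
    unfolding isotropic_def
  proof (safe, simp)
    fix v assume v: "v \<in> M" "v \<noteq> \<zero>\<^bsub>V\<^esub>" "\<phi> v = \<zero>\<^bsub>F\<^esub>"
    then have "v \<in> null_space" using Mc by (auto simp: null_space_def)
    moreover have "\<zero>\<^bsub>V\<^esub> \<in> null_space" by (simp add: null_space_def form_zero)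
    \<comment> \<open>Both pairs have the sum \<open>v\<close>, and sums determine their summands in the complement and in the space of zeros.\<close>
    ultimately have "(v, \<zero>\<^bsub>V\<^esub>) = (\<zero>\<^bsub>V\<^esub>, v)"
      using v Mc M0 by (intro inj_onD[OF inj]) auto
    then show False using v by simp
  qed
  moreover have "isometric F V \<phi> ?D (orthogonal_sum F \<phi> (\<lambda>_. \<zero>\<^bsub>F\<^esub>))"
    unfolding isometric_def
  proof (intro exI conjI ballI)
    let ?f = "inv_into (carrier ?D) ?s"
    show "linear_map F V ?D ?f" by (rule linear_map_inv[OF sum_map_linear[OF M null_space_subspace] bij])
    show "bij_betw ?f (carrier V) (carrier ?D)" by (rule bij_betw_inv_into[OF bij])
    fix v assume v: "v \<in> carrier V"
    then have "?f v \<in> carrier ?D" "?s (?f v) = v"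
      using bij f_inv_into_f[of v ?s "carrier ?D"] by (auto simp: bij_betw_def inv_into_into)
    then show "\<phi> v = orthogonal_sum F \<phi> (\<lambda>_. \<zero>\<^bsub>F\<^esub>) (?f v)"
      using Mc form_add[of "fst (?f v)" "snd (?f v)"]
      by (auto simp: orthogonal_sum_def case_prod_beta' direct_sum_def null_space_def)
  qed
  ultimately show ?thesis
    using subspace_is_vs[OF null_space_subspace] subspace_fin_dim[OF finite_dimensional null_space_subspace]
    by blast
qed

text \<open>Every admissible decomposition has the dimension of the space of zeros as its second dimension, and
  one exists, so the definite description is justified.\<close>

lemma defect_eq_dim_null_space: "defect p F V \<phi> = vectorspace.dim F (vs null_space)"
  unfolding defect_def
proof (rule the_equality)
  obtain W \<alpha> U where *: "quasilinear_form p F (W :: ('a, 'v) module) \<alpha>" "anisotropic F W \<alpha>"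
     "vectorspace F (U :: ('a, 'v) module)" "vectorspace.fin_dim F U"
     "isometric F V \<phi> (direct_sum W U) (orthogonal_sum F \<alpha> (\<lambda>_. \<zero>\<^bsub>F\<^esub>))"
    using decomposition_exists by blast
  then show "\<exists>(W :: ('a, 'v) module) \<phi>an (U :: ('a, 'v) module).
        quasilinear_form p F W \<phi>an \<and> anisotropic F W \<phi>an \<and>
        vectorspace F U \<and> vectorspace.fin_dim F U \<and> vectorspace.dim F U = vectorspace.dim F (vs null_space) \<and>
        isometric F V \<phi> (direct_sum W U) (orthogonal_sum F \<phi>an (\<lambda>_. \<zero>\<^bsub>F\<^esub>))"
    using decomposition_properties(1)[OF *(1,2,3,5)] by blast
qed (use decomposition_properties(1) in blast)

text \<open>Equal defects are exploited through this consequence: the form has the same values as an anisotropic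
  form on a space whose dimension the defect determines.\<close>

lemma anisotropic_part:
  obtains A :: "('a, 'v) module" and \<alpha> \<pi> where "quasilinear_form p F A \<alpha>" "anisotropic F A \<alpha>"
    and "linear_map F V A \<pi>" "\<pi> ` carrier V = carrier A" "\<And>v. v \<in> carrier V \<Longrightarrow> \<phi> v = \<alpha> (\<pi> v)"
    and "vectorspace.dim F A + defect p F V \<phi> = dim"
proof -
  obtain W \<alpha> U where *: "quasilinear_form p F (W :: ('a, 'v) module) \<alpha>" "anisotropic F W \<alpha>"
     "vectorspace F (U :: ('a, 'v) module)" "vectorspace.fin_dim F U"
     "isometric F V \<phi> (direct_sum W U) (orthogonal_sum F \<alpha> (\<lambda>_. \<zero>\<^bsub>F\<^esub>))"
    using decomposition_exists by blast
  then show ?thesis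
    using decomposition_properties(2)[OF *(1,2,3,5)] that unfolding defect_eq_dim_null_space by blast
qed

end

text \<open>An isometry from \<open>x \<phi>\<close> to \<open>\<phi>\<close> moves each \<open>x \<phi>(v)\<close> to a value of \<open>\<phi>\<close>. Conversely, if \<open>x\<close> preserves the
  values of the injective map \<open>\<phi>\<close>, then multiplication by \<open>x\<close> on values comes from an injective
  endomorphism of \<open>V\<close>, which is bijective.\<close>

lemma (in quasilinear_form) similarity_factor_iff:
  assumes an: "anisotropic F V \<phi>" and x: "x \<in> carrier F" "x \<noteq> \<zero>\<^bsub>F\<^esub>"
  shows "x \<in> similarity_factors F V \<phi> \<longleftrightarrow> (\<forall>v\<in>carrier V. x \<otimes>\<^bsub>F\<^esub> \<phi> v \<in> \<phi> ` carrier V)"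
proof -
  have cl: "\<phi> v \<in> carrier F" if "v \<in> carrier V" for v using form_closed that by auto
  have V: "vectorspace F V" by unfold_locales
  have "isometric F V (\<lambda>v. x \<otimes>\<^bsub>F\<^esub> \<phi> v) V \<phi> \<longleftrightarrow> (\<forall>v\<in>carrier V. x \<otimes>\<^bsub>F\<^esub> \<phi> v \<in> \<phi> ` carrier V)"
  proof
    assume "isometric F V (\<lambda>v. x \<otimes>\<^bsub>F\<^esub> \<phi> v) V \<phi>"
    then obtain f where f: "linear_map F V V f" "\<forall>v\<in>carrier V. x \<otimes>\<^bsub>F\<^esub> \<phi> v = \<phi> (f v)"
      unfolding isometric_def by blast
    show "\<forall>v\<in>carrier V. x \<otimes>\<^bsub>F\<^esub> \<phi> v \<in> \<phi> ` carrier V"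
      using f(2) linear_mapD(3)[OF f(1)] by simp
  next
    assume stable: "\<forall>v\<in>carrier V. x \<otimes>\<^bsub>F\<^esub> \<phi> v \<in> \<phi> ` carrier V"
    obtain g where g: "linear_map F V V g" "bij_betw g (carrier V) (carrier V)"
      "\<And>v. v \<in> carrier V \<Longrightarrow> \<phi> (g v) = x \<otimes>\<^bsub>F\<^esub> \<phi> v"
    proof (rule semilinear_factorization[OF V finite_dimensional V finite_dimensional refl,
          of "\<lambda>v. x \<otimes>\<^bsub>F\<^esub> \<phi> v" "add F" "\<lambda>c y. c [^]\<^bsub>F\<^esub> p \<otimes>\<^bsub>F\<^esub> y" \<phi>])
      show "inj_on (\<lambda>v. x \<otimes>\<^bsub>F\<^esub> \<phi> v) (carrier V)"
        using anisotropic_imp_inj[OF an] x cl by (auto simp: inj_on_def m_lcancel)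
      show "inj_on \<phi> (carrier V)" by (rule anisotropic_imp_inj[OF an])
    qed (use x cl stable in \<open>auto simp: form_add form_smult R.r_distr R.m_lcomm\<close>)
    then show "isometric F V (\<lambda>v. x \<otimes>\<^bsub>F\<^esub> \<phi> v) V \<phi>"
      unfolding isometric_def by (intro exI[of _ g] conjI ballI g(1,2) g(3)[symmetric])
  qed
  then show ?thesis using x by (simp add: similarity_factors_def)
qed

section \<open>Scalar extension\<close>

locale scalar_extension_data = V: vectorspace F V + E: field E
  for F :: "'a ring" and V :: "('a, 'v) module" and E :: "'e ring" and \<iota> :: "'a \<Rightarrow> 'e" +
  assumes hom: "\<iota> \<in> ring_hom F E"
begin

abbreviation G where "G \<equiv> formal_tensors E V"
abbreviation N where "N \<equiv> tensor_null F E \<iota> V"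
abbreviation VE where "VE \<equiv> scalar_extension F E \<iota> V"
abbreviation cls where "cls \<equiv> r_coset G N"
abbreviation pure where "pure \<equiv> pure_tensor F E \<iota> V"
abbreviation scale where "scale e \<equiv> frag_extend (\<lambda>(e', v). frag_of (e \<otimes>\<^bsub>E\<^esub> e', v))"

lemma \<iota>_closed [simp]: "c \<in> carrier F \<Longrightarrow> \<iota> c \<in> carrier E"
  using hom by (rule ring_hom_closed)

lemma formal_tensors_comm_group: "comm_group G"
  by (simp add: formal_tensors_def abelian_free_Abelian_group)

sublocale G: comm_group G by (rule formal_tensors_comm_group)

lemma formal_tensors_simps [simp]:
  "x \<in> carrier G \<longleftrightarrow> Poly_Mapping.keys x \<subseteq> carrier E \<times> carrier V"
  "\<one>\<^bsub>G\<^esub> = 0" "x \<otimes>\<^bsub>G\<^esub> y = x + y"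
  by (simp_all add: formal_tensors_def)

lemma formal_tensors_diff:
  assumes "x \<in> carrier G" "y \<in> carrier G"
  shows "x - y \<in> carrier G"
  using assms keys_diff[of x y] by auto

lemma formal_tensors_inv:
  "x \<in> carrier G \<Longrightarrow> inv\<^bsub>G\<^esub> x = - x"
  by (simp add: formal_tensors_def)

lemma relations_subset: "tensor_relations F E \<iota> V \<subseteq> carrier G"
proof -
  have "frag_of a - frag_of b - frag_of c \<in> carrier G" "frag_of a - frag_of b \<in> carrier G"
    if "a \<in> carrier E \<times> carrier V" "b \<in> carrier E \<times> carrier V" "c \<in> carrier E \<times> carrier V" for a b c
    using that by (intro formal_tensors_diff; simp)+
  then show ?thesis unfolding tensor_relations_def by (auto simp del: formal_tensors_simps(1))
qed

lemma null_subgroup: "subgroup N G"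
  unfolding tensor_null_def by (rule G.generate_is_subgroup[OF relations_subset])

sublocale T: comm_group "G Mod N" by (rule G.abelian_FactGroup[OF null_subgroup])

lemma null_normal: "N \<lhd> G" by (rule G.subgroup_imp_normal[OF null_subgroup])

text \<open>Additively, the scalar extension is the quotient of the formal tensors by the null subgroup; computing
  in that quotient gives access to the theory of commutative groups.\<close>

lemma extension_simps [simp]:
  "carrier VE = carrier (G Mod N)"
  "\<zero>\<^bsub>VE\<^esub> = \<one>\<^bsub>G Mod N\<^esub>"
  "S \<oplus>\<^bsub>VE\<^esub> S' = S \<otimes>\<^bsub>G Mod N\<^esub> S'"
  by (simp_all add: scalar_extension_def Let_def)

lemma cls_closed: "x \<in> carrier G \<Longrightarrow> cls x \<in> carrier (G Mod N)"
  by (simp add: carrier_FactGroup del: formal_tensors_simps)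

lemma cls_add:
  "x \<in> carrier G \<Longrightarrow> y \<in> carrier G \<Longrightarrow> cls (x + y) = cls x \<otimes>\<^bsub>G Mod N\<^esub> cls y"
  using normal.rcos_sum[OF null_normal, of x y] by simp

lemma cls_eqI:
  assumes "x \<in> carrier G" "y \<in> carrier G" "x - y \<in> N"
  shows "cls x = cls y"
proof -
  have "x \<in> cls y" using assms(3) unfolding r_coset_def by force
  then show ?thesis using G.repr_independence[OF _ assms(2) null_subgroup] by blast
qed

lemma relation_cls:
  "x - y \<in> tensor_relations F E \<iota> V \<Longrightarrow> x \<in> carrier G \<Longrightarrow> y \<in> carrier G \<Longrightarrow> cls x = cls y"
  by (rule cls_eqI) (auto simp: tensor_null_def intro: generate.incl)

lemma frag_of_closed:
  "e \<in> carrier E \<Longrightarrow> v \<in> carrier V \<Longrightarrow> frag_of (e, v) \<in> carrier G"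
  by simp

lemma pure_closed: "e \<in> carrier E \<Longrightarrow> v \<in> carrier V \<Longrightarrow> pure e v \<in> carrier (G Mod N)"
  unfolding pure_tensor_def by (intro cls_closed frag_of_closed)

lemma pure_add_left:
  assumes "e \<in> carrier E" "e' \<in> carrier E" "v \<in> carrier V"
  shows "pure (e \<oplus>\<^bsub>E\<^esub> e') v = pure e v \<otimes>\<^bsub>G Mod N\<^esub> pure e' v"
proof -
  have "cls (frag_of (e \<oplus>\<^bsub>E\<^esub> e', v)) = cls (frag_of (e, v) + frag_of (e', v))"
    by (rule relation_cls)
      (use assms G.m_closed[of "frag_of (e, v)" "frag_of (e', v)"] in
        \<open>auto simp: tensor_relations_def diff_diff_eq[symmetric]\<close>)
  then show ?thesis using assms by (simp add: pure_tensor_def cls_add)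
qed

lemma pure_add_right:
  assumes "e \<in> carrier E" "v \<in> carrier V" "v' \<in> carrier V"
  shows "pure e (v \<oplus>\<^bsub>V\<^esub> v') = pure e v \<otimes>\<^bsub>G Mod N\<^esub> pure e v'"
proof -
  have "cls (frag_of (e, v \<oplus>\<^bsub>V\<^esub> v')) = cls (frag_of (e, v) + frag_of (e, v'))"
    by (rule relation_cls)
      (use assms G.m_closed[of "frag_of (e, v)" "frag_of (e, v')"] in
        \<open>auto simp: tensor_relations_def diff_diff_eq[symmetric]\<close>)
  then show ?thesis using assms by (simp add: pure_tensor_def cls_add)
qed

lemma pure_balanced:
  assumes "e \<in> carrier E" "c \<in> carrier F" "v \<in> carrier V"
  shows "pure (e \<otimes>\<^bsub>E\<^esub> \<iota> c) v = pure e (c \<odot>\<^bsub>V\<^esub> v)"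
  unfolding pure_tensor_def
  by (rule relation_cls) (use assms in \<open>auto simp: tensor_relations_def\<close>)

lemma pure_zero_left: "v \<in> carrier V \<Longrightarrow> pure \<zero>\<^bsub>E\<^esub> v = \<one>\<^bsub>G Mod N\<^esub>"
  using pure_add_left[of "\<zero>\<^bsub>E\<^esub>" "\<zero>\<^bsub>E\<^esub>" v] pure_closed[of "\<zero>\<^bsub>E\<^esub>" v]
  by (simp del: mult_FactGroup one_FactGroup)

lemma pure_uminus_left:
  assumes "e \<in> carrier E" "v \<in> carrier V"
  shows "cls (- frag_of (e, v)) = pure (\<ominus>\<^bsub>E\<^esub> e) v"
proof -
  have "cls (- frag_of (e, v)) \<otimes>\<^bsub>G Mod N\<^esub> pure e v = \<one>\<^bsub>G Mod N\<^esub>"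
    using cls_add[of "- frag_of (e, v)" "frag_of (e, v)"] assms G.coset_mult_one subgroup.subset[OF null_subgroup]
    by (simp add: pure_tensor_def del: mult_FactGroup formal_tensors_simps(1)) (simp add: G.coset_mult_one subgroup.subset[OF null_subgroup])
  moreover have "pure (\<ominus>\<^bsub>E\<^esub> e) v \<otimes>\<^bsub>G Mod N\<^esub> pure e v = \<one>\<^bsub>G Mod N\<^esub>"
    using pure_add_left[of "\<ominus>\<^bsub>E\<^esub> e" e v] pure_zero_left assms by (simp add: E.l_neg)
  ultimately show ?thesis
    using assms by (metis E.a_inv_closed T.r_cancel pure_closed cls_closed formal_tensors_simps(1) keys_minus frag_of_closed)
qed

text \<open>The pure tensors generate the scalar extension already as a monoid, since
  \<open>- (e \<otimes> v) = (\<ominus> e) \<otimes> v\<close>. Thus additive identities need to be checked on pure tensors only, with no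
  case for differences.\<close>

lemma extension_induct [consumes 1, case_names zero add pure]:
  assumes S: "S \<in> carrier (G Mod N)"
    and zero: "P \<one>\<^bsub>G Mod N\<^esub>"
    and add: "\<And>S S'. S \<in> carrier (G Mod N) \<Longrightarrow> S' \<in> carrier (G Mod N) \<Longrightarrow> P S \<Longrightarrow> P S' \<Longrightarrow>
      P (S \<otimes>\<^bsub>G Mod N\<^esub> S')"
    and pure: "\<And>e v. e \<in> carrier E \<Longrightarrow> v \<in> carrier V \<Longrightarrow> P (pure e v)"
  shows "P S"
proof -
  obtain x where x: "x \<in> carrier G" "S = cls x" using S by (auto simp: carrier_FactGroup)
  have "P (cls x) \<and> P (cls (- x))"
    using x(1) unfolding formal_tensors_simps(1)
  proof (induction x rule: free_Abelian_group_induct[consumes 1, case_names zero diff of])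
    case zero
    have "cls 0 = \<one>\<^bsub>G Mod N\<^esub>"
      using G.coset_mult_one[OF subgroup.subset[OF null_subgroup]] by simp
    then show ?case using \<open>P \<one>\<^bsub>G Mod N\<^esub>\<close> by simp
  next
    case (diff x y)
    have "x \<in> carrier G" "y \<in> carrier G" "- x \<in> carrier G" "- y \<in> carrier G"
      using diff(1,2) by auto
    then show ?case
      using diff(3,4) add[OF cls_closed cls_closed, of x "- y"] add[OF cls_closed cls_closed, of y "- x"]
        cls_add[of x "- y"] cls_add[of y "- x"]
      by (simp del: formal_tensors_simps(1) mult_FactGroup)
  next
    case (of a)
    then obtain e v where a: "a = (e, v)" "e \<in> carrier E" "v \<in> carrier V" by auto
    then show ?case using pure[of e v] pure[of "\<ominus>\<^bsub>E\<^esub> e" v] pure_uminus_left[of e v]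
      by (simp add: pure_tensor_def)
  qed
  then show ?thesis using x(2) by simp
qed

lemma tensor_relationsE:
  assumes "r \<in> tensor_relations F E \<iota> V"
  obtains (left) e e' v where "e \<in> carrier E" "e' \<in> carrier E" "v \<in> carrier V"
      "r = frag_of (e \<oplus>\<^bsub>E\<^esub> e', v) - frag_of (e, v) - frag_of (e', v)"
    | (right) e v v' where "e \<in> carrier E" "v \<in> carrier V" "v' \<in> carrier V"
      "r = frag_of (e, v \<oplus>\<^bsub>V\<^esub> v') - frag_of (e, v) - frag_of (e, v')"
    | (balanced) e c v where "e \<in> carrier E" "c \<in> carrier F" "v \<in> carrier V"
      "r = frag_of (e \<otimes>\<^bsub>E\<^esub> \<iota> c, v) - frag_of (e, c \<odot>\<^bsub>V\<^esub> v)"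
  using assms unfolding tensor_relations_def
  by (elim UnE CollectE exE conjE) (rule that; assumption)+

lemma tensor_relationsI:
  "e \<in> carrier E \<Longrightarrow> e' \<in> carrier E \<Longrightarrow> v \<in> carrier V \<Longrightarrow>
    frag_of (e \<oplus>\<^bsub>E\<^esub> e', v) - frag_of (e, v) - frag_of (e', v) \<in> tensor_relations F E \<iota> V"
  "e \<in> carrier E \<Longrightarrow> v \<in> carrier V \<Longrightarrow> v' \<in> carrier V \<Longrightarrow>
    frag_of (e, v \<oplus>\<^bsub>V\<^esub> v') - frag_of (e, v) - frag_of (e, v') \<in> tensor_relations F E \<iota> V"
  "e \<in> carrier E \<Longrightarrow> c \<in> carrier F \<Longrightarrow> v \<in> carrier V \<Longrightarrow>
    frag_of (e \<otimes>\<^bsub>E\<^esub> \<iota> c, v) - frag_of (e, c \<odot>\<^bsub>V\<^esub> v) \<in> tensor_relations F E \<iota> V"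
  unfolding tensor_relations_def by blast+

text \<open>A biadditive balanced map extends to the free abelian group, and balancedness together with
  biadditivity says that the extension kills the defining relations.\<close>

lemma extension_universal:
  assumes A: "comm_group A"
    and \<beta>: "\<And>e v. e \<in> carrier E \<Longrightarrow> v \<in> carrier V \<Longrightarrow> \<beta> e v \<in> carrier A"
    and add_left: "\<And>e e' v. e \<in> carrier E \<Longrightarrow> e' \<in> carrier E \<Longrightarrow> v \<in> carrier V \<Longrightarrow>
      \<beta> (e \<oplus>\<^bsub>E\<^esub> e') v = \<beta> e v \<otimes>\<^bsub>A\<^esub> \<beta> e' v"
    and add_right: "\<And>e v v'. e \<in> carrier E \<Longrightarrow> v \<in> carrier V \<Longrightarrow> v' \<in> carrier V \<Longrightarrow>
      \<beta> e (v \<oplus>\<^bsub>V\<^esub> v') = \<beta> e v \<otimes>\<^bsub>A\<^esub> \<beta> e v'"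
    and beta_balanced: "\<And>e c v. e \<in> carrier E \<Longrightarrow> c \<in> carrier F \<Longrightarrow> v \<in> carrier V \<Longrightarrow>
      \<beta> (e \<otimes>\<^bsub>E\<^esub> \<iota> c) v = \<beta> e (c \<odot>\<^bsub>V\<^esub> v)"
  obtains h where "h \<in> hom (G Mod N) A"
    "\<And>e v. e \<in> carrier E \<Longrightarrow> v \<in> carrier V \<Longrightarrow> h (pure e v) = \<beta> e v"
proof -
  interpret A: comm_group A by fact
  have "(\<lambda>(e, v). \<beta> e v) ` (carrier E \<times> carrier V) \<subseteq> carrier A" using \<beta> by auto
  then obtain h0 where h0: "h0 \<in> hom (free_Abelian_group (carrier E \<times> carrier V)) A"
    "\<And>x. x \<in> carrier E \<times> carrier V \<Longrightarrow> h0 (frag_of x) = (\<lambda>(e, v). \<beta> e v) x"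
    using A.free_Abelian_group_universal by blast
  then have h: "h0 \<in> hom G A" by (simp add: formal_tensors_def)
  have h0\<beta>: "h0 (frag_of (e, v)) = \<beta> e v" if "e \<in> carrier E" "v \<in> carrier V" for e v
    using h0(2) that by simp
  interpret h: group_hom G A h0 using h by unfold_locales
  have h_diff: "h0 (x - y) = h0 x \<otimes>\<^bsub>A\<^esub> inv\<^bsub>A\<^esub> h0 y" if "x \<in> carrier G" "y \<in> carrier G" for x y
    using h.hom_mult[of x "inv\<^bsub>G\<^esub> y"] that h.hom_inv[of y] formal_tensors_inv[of y] by simp
  have "tensor_relations F E \<iota> V \<subseteq> kernel G A h0"
  proof
    fix r assume r: "r \<in> tensor_relations F E \<iota> V"
    have h_diff2: "h0 (a - b - c) = \<one>\<^bsub>A\<^esub>"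
      if "a \<in> carrier G" "b \<in> carrier G" "c \<in> carrier G" "h0 a = h0 b \<otimes>\<^bsub>A\<^esub> h0 c" for a b c
    proof -
      have "h0 (a - b - c) = h0 a \<otimes>\<^bsub>A\<^esub> inv\<^bsub>A\<^esub> h0 b \<otimes>\<^bsub>A\<^esub> inv\<^bsub>A\<^esub> h0 c"
        using that formal_tensors_diff by (simp add: h_diff del: formal_tensors_simps)
      also have "\<dots> = h0 a \<otimes>\<^bsub>A\<^esub> inv\<^bsub>A\<^esub> (h0 b \<otimes>\<^bsub>A\<^esub> h0 c)"
        using that by (simp add: A.inv_mult A.m_assoc h.hom_closed del: formal_tensors_simps)
      finally show ?thesis using that by (simp add: h.hom_closed del: formal_tensors_simps)
    qed
    have "h0 r = \<one>\<^bsub>A\<^esub>"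
      using r
    proof (cases rule: tensor_relationsE)
      case (left e e' v)
      then show ?thesis using frag_of_closed by (auto intro!: h_diff2 simp: h0\<beta> add_left)
    next
      case (right e v v')
      then show ?thesis using frag_of_closed by (auto intro!: h_diff2 simp: h0\<beta> add_right)
    next
      case (balanced e c v)
      then show ?thesis
        using frag_of_closed h_diff[of "frag_of (e \<otimes>\<^bsub>E\<^esub> \<iota> c, v)" "frag_of (e, c \<odot>\<^bsub>V\<^esub> v)"]
        by (simp add: h0\<beta> beta_balanced \<beta>)
    qed
    then show "r \<in> kernel G A h0"
      using r relations_subset by (auto simp: kernel_def simp del: formal_tensors_simps)
  qed
  then have "N \<subseteq> kernel G A h0"
    unfolding tensor_null_def by (intro G.generate_subgroup_incl h.subgroup_kernel)
  then obtain g where "g \<in> hom (G Mod N) A" "\<And>x. x \<in> carrier G \<Longrightarrow> g (cls x) = h0 x"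
    using h.FactGroup_universal_kernel[OF null_normal] by blast
  then show ?thesis using that h0\<beta> by (simp add: pure_tensor_def)
qed

lemma scale_closed:
  assumes "e \<in> carrier E" "x \<in> carrier G"
  shows "scale e x \<in> carrier G"
proof -
  have "Poly_Mapping.keys (scale e x) \<subseteq>
      (\<Union>z\<in>Poly_Mapping.keys x. Poly_Mapping.keys (case z of (e', v) \<Rightarrow> frag_of (e \<otimes>\<^bsub>E\<^esub> e', v)))"
    by (rule keys_frag_extend)
  also have "\<dots> \<subseteq> carrier E \<times> carrier V"
  proof (rule UN_least)
    fix z assume "z \<in> Poly_Mapping.keys x"
    then have "z \<in> carrier E \<times> carrier V" using assms(2) unfolding formal_tensors_simps by (rule rev_subsetD)
    then show "Poly_Mapping.keys (case z of (e', v) \<Rightarrow> frag_of (e \<otimes>\<^bsub>E\<^esub> e', v)) \<subseteq> carrier E \<times> carrier V"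
      using assms(1) by (cases z) simp
  qed
  finally show ?thesis by simp
qed

text \<open>Multiplying the left factors by \<open>e\<close> turns each defining relation into a relation of the same kind,
  so it passes to the quotient.\<close>

lemma scale_null:
  assumes e: "e \<in> carrier E" and x: "x \<in> N"
  shows "scale e x \<in> N"
proof -
  have rel: "scale e r \<in> tensor_relations F E \<iota> V" if "r \<in> tensor_relations F E \<iota> V" for r
    using that
  proof (cases rule: tensor_relationsE)
    case (left d d' v)
    have "scale e r = frag_of (e \<otimes>\<^bsub>E\<^esub> d \<oplus>\<^bsub>E\<^esub> e \<otimes>\<^bsub>E\<^esub> d', v) - frag_of (e \<otimes>\<^bsub>E\<^esub> d, v) - frag_of (e \<otimes>\<^bsub>E\<^esub> d', v)"
      using left e by (simp add: frag_extend_diff E.r_distr)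
    then show ?thesis using tensor_relationsI(1)[of "e \<otimes>\<^bsub>E\<^esub> d" "e \<otimes>\<^bsub>E\<^esub> d'" v] left e by simp
  next
    case (right d v v')
    have "scale e r = frag_of (e \<otimes>\<^bsub>E\<^esub> d, v \<oplus>\<^bsub>V\<^esub> v') - frag_of (e \<otimes>\<^bsub>E\<^esub> d, v) - frag_of (e \<otimes>\<^bsub>E\<^esub> d, v')"
      using right e by (simp add: frag_extend_diff)
    then show ?thesis using tensor_relationsI(2)[of "e \<otimes>\<^bsub>E\<^esub> d" v v'] right e by simp
  next
    case (balanced d c v)
    have "scale e r = frag_of (e \<otimes>\<^bsub>E\<^esub> d \<otimes>\<^bsub>E\<^esub> \<iota> c, v) - frag_of (e \<otimes>\<^bsub>E\<^esub> d, c \<odot>\<^bsub>V\<^esub> v)"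
      using balanced e by (simp add: frag_extend_diff E.m_assoc)
    then show ?thesis using tensor_relationsI(3)[of "e \<otimes>\<^bsub>E\<^esub> d" c v] balanced e by simp
  qed
  show ?thesis
    using x unfolding tensor_null_def
  proof (induction x rule: generate.induct)
    case one
    then show ?case using generate.one[of G] by simp
  next
    case (incl r)
    then show ?case by (intro generate.incl rel)
  next
    case (inv r)
    then have "r \<in> carrier G" "scale e r \<in> carrier G" using relations_subset rel by blast+
    then show ?case using generate.inv[OF rel[OF inv], of G]
      by (simp add: formal_tensors_inv frag_extend_minus del: formal_tensors_simps)
  next
    case (eng x y)
    then show ?case using generate.eng[of "scale e x" G _ "scale e y"] by (simp add: frag_extend_add)
  qed
qed

text \<open>All representatives of a class yield the same class, so the union in the definition of the scalar
  action is over a single set.\<close>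

lemma smult_cls:
  assumes e: "e \<in> carrier E" and x: "x \<in> carrier G"
  shows "e \<odot>\<^bsub>VE\<^esub> cls x = cls (scale e x)"
proof -
  have "cls (scale e y) = cls (scale e x)" if y: "y \<in> cls x" for y
  proof -
    obtain n where n: "n \<in> N" "y = n + x" using y by (auto simp: r_coset_def)
    then have "y \<in> carrier G"
      using x subgroup.mem_carrier[OF null_subgroup n(1)] G.m_closed[of n x] by simp
    moreover have "scale e y - scale e x \<in> N" using scale_null[OF e n(1)] n by (simp add: frag_extend_add)
    ultimately show ?thesis using x by (intro cls_eqI scale_closed[OF e])
  qed
  moreover have "x \<in> cls x" by (rule G.rcos_self[OF x null_subgroup])
  ultimately have "(\<Union>y\<in>cls x. cls (scale e y)) = cls (scale e x)" by blast
  then show ?thesis by (simp add: scalar_extension_def Let_def)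
qed

lemma smult_pure:
  "e \<in> carrier E \<Longrightarrow> d \<in> carrier E \<Longrightarrow> v \<in> carrier V \<Longrightarrow> e \<odot>\<^bsub>VE\<^esub> pure d v = pure (e \<otimes>\<^bsub>E\<^esub> d) v"
  by (simp add: pure_tensor_def smult_cls)

lemma smult_closed:
  "e \<in> carrier E \<Longrightarrow> S \<in> carrier (G Mod N) \<Longrightarrow> e \<odot>\<^bsub>VE\<^esub> S \<in> carrier (G Mod N)"
  using smult_cls cls_closed scale_closed by (auto simp: carrier_FactGroup simp del: formal_tensors_simps)

lemma smult_add:
  assumes "e \<in> carrier E" "S \<in> carrier (G Mod N)" "S' \<in> carrier (G Mod N)"
  shows "e \<odot>\<^bsub>VE\<^esub> (S \<otimes>\<^bsub>G Mod N\<^esub> S') = (e \<odot>\<^bsub>VE\<^esub> S) \<otimes>\<^bsub>G Mod N\<^esub> (e \<odot>\<^bsub>VE\<^esub> S')"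
proof -
  obtain x y where xy: "x \<in> carrier G" "y \<in> carrier G" "S = cls x" "S' = cls y"
    using assms by (auto simp: carrier_FactGroup)
  have xy': "x + y \<in> carrier G" using G.m_closed[OF xy(1,2)] by simp
  have "S \<otimes>\<^bsub>G Mod N\<^esub> S' = cls (x + y)" unfolding xy by (rule cls_add[OF xy(1,2), symmetric])
  then have "e \<odot>\<^bsub>VE\<^esub> (S \<otimes>\<^bsub>G Mod N\<^esub> S') = cls (scale e x + scale e y)"
    using smult_cls[OF assms(1) xy'] by (simp only: frag_extend_add)
  also have "\<dots> = cls (scale e x) \<otimes>\<^bsub>G Mod N\<^esub> cls (scale e y)"
    by (intro cls_add scale_closed assms xy)
  finally show ?thesis unfolding xy smult_cls[OF assms(1) xy(1)] smult_cls[OF assms(1) xy(2)] .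
qed

lemma smult_zero:
  assumes e: "e \<in> carrier E"
  shows "e \<odot>\<^bsub>VE\<^esub> \<one>\<^bsub>G Mod N\<^esub> = \<one>\<^bsub>G Mod N\<^esub>"
proof -
  have "(e \<odot>\<^bsub>VE\<^esub> \<one>\<^bsub>G Mod N\<^esub>) \<otimes>\<^bsub>G Mod N\<^esub> (e \<odot>\<^bsub>VE\<^esub> \<one>\<^bsub>G Mod N\<^esub>) = e \<odot>\<^bsub>VE\<^esub> \<one>\<^bsub>G Mod N\<^esub>"
    using smult_add[OF e T.one_closed T.one_closed] T.l_one[OF T.one_closed] by (simp only:)
  then show ?thesis
    using T.l_cancel_one[OF smult_closed[OF e T.one_closed] smult_closed[OF e T.one_closed]] by (simp only:)
qed

lemma smult_assoc:
  assumes a: "a \<in> carrier E" and b: "b \<in> carrier E" and "S \<in> carrier (G Mod N)"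
  shows "(a \<otimes>\<^bsub>E\<^esub> b) \<odot>\<^bsub>VE\<^esub> S = a \<odot>\<^bsub>VE\<^esub> (b \<odot>\<^bsub>VE\<^esub> S)"
  using assms(3)
proof (induction rule: extension_induct)
  case zero
  show ?case by (simp only: smult_zero a b E.m_closed)
next
  case (add S S')
  then show ?case by (simp only: smult_add smult_closed a b E.m_closed)
next
  case (pure e v)
  then show ?case by (simp only: smult_pure a b E.m_closed E.m_assoc)
qed

lemma add_smult:
  assumes a: "a \<in> carrier E" and b: "b \<in> carrier E" and "S \<in> carrier (G Mod N)"
  shows "(a \<oplus>\<^bsub>E\<^esub> b) \<odot>\<^bsub>VE\<^esub> S = (a \<odot>\<^bsub>VE\<^esub> S) \<otimes>\<^bsub>G Mod N\<^esub> (b \<odot>\<^bsub>VE\<^esub> S)"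
  using assms(3)
proof (induction rule: extension_induct)
  case zero
  show ?case by (simp only: smult_zero a b E.a_closed T.l_one T.one_closed)
next
  case (add S S')
  then show ?case by (simp only: smult_add smult_closed a b E.a_closed T.m_ac T.m_closed)
next
  case (pure e v)
  then show ?case by (simp only: smult_pure a b E.a_closed E.m_closed E.l_distr pure_add_left)
qed

lemma smult_one:
  assumes "S \<in> carrier (G Mod N)"
  shows "\<one>\<^bsub>E\<^esub> \<odot>\<^bsub>VE\<^esub> S = S"
  using assms
proof (induction rule: extension_induct)
  case zero
  show ?case by (simp only: smult_zero E.one_closed)
next
  case (add S S')
  then show ?case by (simp only: smult_add E.one_closed)
next
  case (pure e v)
  then show ?case by (simp only: smult_pure E.one_closed E.l_one)
qed

lemma extension_vectorspace: "vectorspace E VE"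
proof (rule vs_criteria[OF E.field_axioms], unfold extension_simps)
  show "\<forall>S\<in>carrier (G Mod N). \<exists>S'\<in>carrier (G Mod N). S \<otimes>\<^bsub>G Mod N\<^esub> S' = \<one>\<^bsub>G Mod N\<^esub>"
  proof
    fix S assume "S \<in> carrier (G Mod N)"
    then show "\<exists>S'\<in>carrier (G Mod N). S \<otimes>\<^bsub>G Mod N\<^esub> S' = \<one>\<^bsub>G Mod N\<^esub>"
      using T.r_inv[of S] T.inv_closed[of S] by blast
  qed
qed (rule T.one_closed, (intro allI ballI impI, (elim conjE)?,
    (rule T.m_closed T.m_comm T.m_assoc T.r_one smult_closed smult_add smult_assoc smult_one add_smult;
      assumption))+)

sublocale VE: vectorspace E VE by (rule extension_vectorspace)

text \<open>The tensors \<open>1 \<otimes> b\<close> with \<open>b\<close> in a finite generating set of \<open>V\<close> generate: the vectors \<open>v\<close> for which \<open>1 \<otimes> v\<close>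
  lies in their span form a subspace containing all \<open>b\<close>, and \<open>e \<otimes> v = e (1 \<otimes> v)\<close>.\<close>

lemma extension_fin_dim:
  assumes "V.fin_dim"
  shows "VE.fin_dim"
proof -
  obtain B where B: "finite B" "B \<subseteq> carrier V" "V.span B = carrier V"
    using assms unfolding V.fin_dim_def by blast
  let ?P = "pure \<one>\<^bsub>E\<^esub> ` B"
  have P: "?P \<subseteq> carrier VE" unfolding extension_simps using B(2) pure_closed[OF E.one_closed] by blast
  have sub: "submodule E (VE.span ?P) VE" by (rule VE.span_is_submodule[OF P])
  note sub_m = submodule.m_closed[OF sub, unfolded extension_simps]
    and sub_s = submodule.smult_closed[OF sub]
  have "submodule F {v \<in> carrier V. pure \<one>\<^bsub>E\<^esub> v \<in> VE.span ?P} V"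
  proof (rule submodule.intro)
    have "\<zero>\<^bsub>F\<^esub> \<odot>\<^bsub>V\<^esub> \<zero>\<^bsub>V\<^esub> = \<zero>\<^bsub>V\<^esub>" by simp
    then have "pure \<one>\<^bsub>E\<^esub> \<zero>\<^bsub>V\<^esub> = pure \<zero>\<^bsub>E\<^esub> \<zero>\<^bsub>V\<^esub>"
      using pure_balanced[of "\<one>\<^bsub>E\<^esub>" "\<zero>\<^bsub>F\<^esub>" "\<zero>\<^bsub>V\<^esub>"] hom ring_hom_zero[OF hom V.R.ring_axioms E.ring_axioms]
      by simp
    then have "pure \<one>\<^bsub>E\<^esub> \<zero>\<^bsub>V\<^esub> = \<zero>\<^bsub>VE\<^esub>"
      unfolding extension_simps using pure_zero_left[OF V.M.zero_closed] by (simp only:)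
    then show "\<zero>\<^bsub>V\<^esub> \<in> {v \<in> carrier V. pure \<one>\<^bsub>E\<^esub> v \<in> VE.span ?P}"
      using submodule.zero_closed[OF sub] V.M.zero_closed by (simp only: mem_Collect_eq)
  next
    show "module F V" by (rule V.module_axioms)
  next
    fix v w assume vw: "v \<in> {v \<in> carrier V. pure \<one>\<^bsub>E\<^esub> v \<in> VE.span ?P}"
      "w \<in> {v \<in> carrier V. pure \<one>\<^bsub>E\<^esub> v \<in> VE.span ?P}"
    then show "v \<oplus>\<^bsub>V\<^esub> w \<in> {v \<in> carrier V. pure \<one>\<^bsub>E\<^esub> v \<in> VE.span ?P}"
      using sub_m[of "pure \<one>\<^bsub>E\<^esub> v" "pure \<one>\<^bsub>E\<^esub> w"]
      by (simp only: mem_Collect_eq pure_add_right[OF E.one_closed] V.M.a_closed)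
  next
    fix c v assume cv: "c \<in> carrier F" "v \<in> {v \<in> carrier V. pure \<one>\<^bsub>E\<^esub> v \<in> VE.span ?P}"
    then have "pure \<one>\<^bsub>E\<^esub> (c \<odot>\<^bsub>V\<^esub> v) = \<iota> c \<odot>\<^bsub>VE\<^esub> pure \<one>\<^bsub>E\<^esub> v"
      using pure_balanced[of "\<one>\<^bsub>E\<^esub>" c v] by (simp add: smult_pure)
    then show "c \<odot>\<^bsub>V\<^esub> v \<in> {v \<in> carrier V. pure \<one>\<^bsub>E\<^esub> v \<in> VE.span ?P}"
      using cv sub_s[of "\<iota> c" "pure \<one>\<^bsub>E\<^esub> v"] by simp
  qed auto
  then have "V.span B \<subseteq> {v \<in> carrier V. pure \<one>\<^bsub>E\<^esub> v \<in> VE.span ?P}"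
    by (rule V.span_is_subset[rotated]) (use B(2) VE.span_mem[OF P] in blast)
  then have one: "pure \<one>\<^bsub>E\<^esub> v \<in> VE.span ?P" if "v \<in> carrier V" for v
    using B(3) that by blast
  have "S \<in> VE.span ?P" if "S \<in> carrier (G Mod N)" for S
    using that
  proof (induction rule: extension_induct)
    case zero
    then show ?case using submodule.zero_closed[OF sub] by (simp only: extension_simps)
  next
    case (add S S')
    show ?case by (rule sub_m[OF add(3,4)])
  next
    case (pure e v)
    then show ?case using sub_s[OF pure(1) one[OF pure(2)]] by (simp only: smult_pure E.one_closed E.r_one)
  qed
  then have "VE.span ?P = carrier VE"
    using VE.span_is_subset2[OF P] unfolding extension_simps by blast
  then show ?thesis using B(1) P unfolding VE.fin_dim_def by blast
qed

lemma extended_form_unique: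
  assumes "quasilinear_form p E VE \<Phi>" "\<Phi> \<in> extensional (carrier VE)"
    and "quasilinear_form p E VE \<Psi>" "\<Psi> \<in> extensional (carrier VE)"
    and eq: "\<And>e v. e \<in> carrier E \<Longrightarrow> v \<in> carrier V \<Longrightarrow> \<Phi> (pure e v) = \<Psi> (pure e v)"
  shows "\<Phi> = \<Psi>"
proof (rule extensionalityI[OF assms(2,4)])
  fix S assume "S \<in> carrier VE"
  then have "S \<in> carrier (G Mod N)" by (simp only: extension_simps)
  then show "\<Phi> S = \<Psi> S"
  proof (induction rule: extension_induct)
    case zero
    show ?case
      using quasilinear_form.form_zero[OF assms(1)] quasilinear_form.form_zero[OF assms(3)]
      by (simp only: extension_simps)
  next
    case (add S S')
    then show ?case
      using quasilinear_form.form_add[OF assms(1)] quasilinear_form.form_add[OF assms(3)]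
      by (simp only: extension_simps)
  next
    case (pure e v)
    then show ?case by (rule eq)
  qed
qed

text \<open>The map \<open>(e, v) \<mapsto> e\<^sup>p \<iota>(\<phi> v)\<close> is additive in \<open>e\<close> by the Frobenius identity, and it is balanced because a scalar
  of \<open>F\<close> contributes its \<open>p\<close>-th power on either side.\<close>

lemma extended_form_exists:
  assumes \<phi>: "quasilinear_form p F V \<phi>" and char: "has_characteristic E p"
  obtains \<Phi> where "quasilinear_form p E VE \<Phi>" "\<Phi> \<in> extensional (carrier VE)"
    "\<And>e v. e \<in> carrier E \<Longrightarrow> v \<in> carrier V \<Longrightarrow> \<Phi> (pure e v) = e [^]\<^bsub>E\<^esub> p \<otimes>\<^bsub>E\<^esub> \<iota> (\<phi> v)"
proof -
  interpret \<phi>: quasilinear_form p F V \<phi> by fact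
  have char1: "[p] \<cdot>\<^bsub>E\<^esub> \<one>\<^bsub>E\<^esub> = \<zero>\<^bsub>E\<^esub>"
    by (rule E.has_characteristic_add_pow[OF char])
  have \<iota>\<phi>: "\<iota> (\<phi> v) \<in> carrier E" if "v \<in> carrier V" for v
    by (rule \<iota>_closed, rule funcset_mem[OF \<phi>.form_closed that])
  have \<iota>_pow: "\<iota> (c [^]\<^bsub>F\<^esub> n) = \<iota> c [^]\<^bsub>E\<^esub> n" if "c \<in> carrier F" for c and n :: nat
  proof -
    interpret \<iota>: ring_hom_cring F E \<iota>
      using hom by unfold_locales
    show ?thesis using that by (rule \<iota>.hom_pow)
  qed
  let ?\<beta> = "\<lambda>e v. e [^]\<^bsub>E\<^esub> p \<otimes>\<^bsub>E\<^esub> \<iota> (\<phi> v)"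
  obtain h where h: "h \<in> hom (G Mod N) (add_monoid E)"
    and h\<beta>: "\<And>e v. e \<in> carrier E \<Longrightarrow> v \<in> carrier V \<Longrightarrow> h (pure e v) = ?\<beta> e v"
  proof (rule extension_universal[OF E.a_comm_group, of ?\<beta>])
    show "?\<beta> (e \<oplus>\<^bsub>E\<^esub> e') v = ?\<beta> e v \<otimes>\<^bsub>add_monoid E\<^esub> ?\<beta> e' v"
      if "e \<in> carrier E" "e' \<in> carrier E" "v \<in> carrier V" for e e' v
      using that \<iota>\<phi> E.frobenius_add[OF \<phi>.prime char1] by (simp add: E.l_distr)
    show "?\<beta> e (v \<oplus>\<^bsub>V\<^esub> v') = ?\<beta> e v \<otimes>\<^bsub>add_monoid E\<^esub> ?\<beta> e v'"
      if "e \<in> carrier E" "v \<in> carrier V" "v' \<in> carrier V" for e v v'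
      using that \<iota>\<phi> \<phi>.form_closed ring_hom_add[OF hom] \<phi>.form_add by (simp add: E.r_distr Pi_iff)
    show "?\<beta> (e \<otimes>\<^bsub>E\<^esub> \<iota> c) v = ?\<beta> e (c \<odot>\<^bsub>V\<^esub> v)"
      if "e \<in> carrier E" "c \<in> carrier F" "v \<in> carrier V" for e c v
      using that \<iota>\<phi> \<phi>.form_closed \<phi>.form_smult ring_hom_mult[OF hom]
      by (simp add: E.nat_pow_distrib \<iota>_pow Pi_iff E.m_assoc)
  qed (use \<iota>\<phi> in auto)
  have h_closed: "h S \<in> carrier E" if "S \<in> carrier (G Mod N)" for S
    using hom_in_carrier[OF h that] by simp
  have h_add: "h (S \<otimes>\<^bsub>G Mod N\<^esub> S') = h S \<oplus>\<^bsub>E\<^esub> h S'"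
    if "S \<in> carrier (G Mod N)" "S' \<in> carrier (G Mod N)" for S S'
    using hom_mult[OF h that] by simp
  interpret h: group_hom "G Mod N" "add_monoid E" h using h by unfold_locales
  have h_zero: "h \<one>\<^bsub>G Mod N\<^esub> = \<zero>\<^bsub>E\<^esub>" using h.hom_one by (simp only: monoid.simps)
  have h_smult: "h (e \<odot>\<^bsub>VE\<^esub> S) = e [^]\<^bsub>E\<^esub> p \<otimes>\<^bsub>E\<^esub> h S" if e: "e \<in> carrier E" and S: "S \<in> carrier (G Mod N)" for e S
    using S
  proof (induction rule: extension_induct)
    case zero
    show ?case using e by (simp only: smult_zero h_zero E.r_null E.nat_pow_closed)
  next
    case (add S S')
    then show ?case using e
      by (simp only: smult_add smult_closed h_add h_closed E.r_distr E.nat_pow_closed)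
  next
    case (pure d v)
    then show ?case using e \<iota>\<phi>
      by (simp only: smult_pure E.m_closed h\<beta> E.nat_pow_distrib E.m_assoc E.nat_pow_closed)
  qed
  have "quasilinear_form p E VE (restrict h (carrier VE))"
    unfolding quasilinear_form_def quasilinear_form_axioms_def
  proof (intro conjI allI impI)
    show "restrict h (carrier VE) \<in> carrier VE \<rightarrow> carrier E"
      using h_closed unfolding extension_simps by auto
    show "restrict h (carrier VE) (e \<odot>\<^bsub>VE\<^esub> S) = e [^]\<^bsub>E\<^esub> p \<otimes>\<^bsub>E\<^esub> restrict h (carrier VE) S"
      if "e \<in> carrier E" "S \<in> carrier VE" for e S
      using that h_smult smult_closed unfolding extension_simps by (simp only: restrict_apply if_True)
    show "restrict h (carrier VE) (S \<oplus>\<^bsub>VE\<^esub> S') = restrict h (carrier VE) S \<oplus>\<^bsub>E\<^esub> restrict h (carrier VE) S'"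
      if "S \<in> carrier VE" "S' \<in> carrier VE" for S S'
      using that h_add T.m_closed unfolding extension_simps by (simp only: restrict_apply if_True)
  qed (rule extension_vectorspace \<phi>.prime char extension_fin_dim \<phi>.finite_dimensional)+
  then show ?thesis
    using that[of "restrict h (carrier VE)"] h\<beta> pure_closed by (simp del: mult_FactGroup one_FactGroup)
qed

lemma extended_form_properties:
  assumes \<phi>: "quasilinear_form p F V \<phi>" and char: "has_characteristic E p"
  shows "quasilinear_form p E VE (extended_form p F E \<iota> V \<phi>)"
    and "\<And>e v. e \<in> carrier E \<Longrightarrow> v \<in> carrier V \<Longrightarrow>
      extended_form p F E \<iota> V \<phi> (pure e v) = e [^]\<^bsub>E\<^esub> p \<otimes>\<^bsub>E\<^esub> \<iota> (\<phi> v)"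
proof -
  let ?P = "\<lambda>\<Phi>. quasilinear_form p E VE \<Phi> \<and> \<Phi> \<in> extensional (carrier VE) \<and>
    (\<forall>e\<in>carrier E. \<forall>v\<in>carrier V. \<Phi> (pure e v) = e [^]\<^bsub>E\<^esub> p \<otimes>\<^bsub>E\<^esub> \<iota> (\<phi> v))"
  have "\<exists>!\<Phi>. ?P \<Phi>"
  proof (rule ex_ex1I)
    show "\<exists>\<Phi>. ?P \<Phi>" using extended_form_exists[OF assms] by metis
    show "\<Phi> = \<Psi>" if "?P \<Phi>" "?P \<Psi>" for \<Phi> \<Psi>
      using that by (intro extended_form_unique[of p \<Phi> \<Psi>]) auto
  qed
  then have "?P (extended_form p F E \<iota> V \<phi>)" unfolding extended_form_def by (rule theI')
  then show "quasilinear_form p E VE (extended_form p F E \<iota> V \<phi>)"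
    "\<And>e v. e \<in> carrier E \<Longrightarrow> v \<in> carrier V \<Longrightarrow>
      extended_form p F E \<iota> V \<phi> (pure e v) = e [^]\<^bsub>E\<^esub> p \<otimes>\<^bsub>E\<^esub> \<iota> (\<phi> v)"
    by blast+
qed

end

lemma scalar_extension_map:
  assumes E: "field E" and \<iota>: "\<iota> \<in> ring_hom F E" and f: "linear_map F V W f"
  obtains h where "linear_map E (scalar_extension F E \<iota> V) (scalar_extension F E \<iota> W) h"
    "\<And>e v. e \<in> carrier E \<Longrightarrow> v \<in> carrier V \<Longrightarrow>
      h (pure_tensor F E \<iota> V e v) = pure_tensor F E \<iota> W e (f v)"
proof -
  note fD = linear_mapD[OF f]
  interpret V: scalar_extension_data F V E \<iota>
    by (intro scalar_extension_data.intro scalar_extension_data_axioms.intro fD(1) E \<iota>)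
  interpret W: scalar_extension_data F W E \<iota>
    by (intro scalar_extension_data.intro scalar_extension_data_axioms.intro fD(2) E \<iota>)
  obtain h where h: "h \<in> hom (V.G Mod V.N) (W.G Mod W.N)"
    and hp: "\<And>e v. e \<in> carrier E \<Longrightarrow> v \<in> carrier V \<Longrightarrow> h (V.pure e v) = W.pure e (f v)"
  proof (rule V.extension_universal[OF W.T.comm_group_axioms, of "\<lambda>e v. W.pure e (f v)"])
  qed (simp_all only: fD(3-5) W.pure_closed W.pure_add_left W.pure_add_right W.pure_balanced)
  interpret h: group_hom "V.G Mod V.N" "W.G Mod W.N" h using h by unfold_locales
  have "h (e \<odot>\<^bsub>V.VE\<^esub> S) = e \<odot>\<^bsub>W.VE\<^esub> h S" if e: "e \<in> carrier E" and "S \<in> carrier (V.G Mod V.N)" for e S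
    using that(2)
  proof (induction rule: V.extension_induct)
    case zero
    show ?case using e by (simp only: V.smult_zero W.smult_zero h.hom_one)
  next
    case (add S S')
    then show ?case using e
      by (simp only: V.smult_add W.smult_add V.smult_closed h.hom_mult h.hom_closed)
  next
    case (pure d v)
    then show ?case using e by (simp only: V.smult_pure W.smult_pure hp V.E.m_closed fD(3))
  qed
  then have "linear_map E V.VE W.VE h"
    by (intro linear_mapI V.extension_vectorspace W.extension_vectorspace)
      (simp_all only: V.extension_simps W.extension_simps h.hom_mult, use h.hom_closed in blast)
  then show ?thesis using that hp by blast
qed

text \<open>Spaces of equal dimension are isomorphic, and a linear bijection and its inverse induce mutually
  inverse linear maps of the scalar extensions.\<close>

lemma scalar_extension_dim_cong:
  assumes E: "field E" and \<iota>: "\<iota> \<in> ring_hom F E"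
    and V: "vectorspace F V" "vectorspace.fin_dim F V"
    and W: "vectorspace F W" "vectorspace.fin_dim F W"
    and dim: "vectorspace.dim F V = vectorspace.dim F W"
  shows "vectorspace.dim E (scalar_extension F E \<iota> V) = vectorspace.dim E (scalar_extension F E \<iota> W)"
proof -
  obtain f where f: "linear_map F V W f" and bij: "bij_betw f (carrier V) (carrier W)"
    using equal_dim_imp_linear_bij[OF V W dim] by blast
  let ?g = "inv_into (carrier V) f"
  have g: "linear_map F W V ?g" by (rule linear_map_inv[OF f bij])
  note fD = linear_mapD[OF f] and gD = linear_mapD[OF g]
  have gf: "?g (f v) = v" if "v \<in> carrier V" for v using bij that by (auto simp: bij_betw_def)
  have fg: "f (?g w) = w" if "w \<in> carrier W" for w using bij that by (auto simp: bij_betw_def f_inv_into_f)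
  interpret V: scalar_extension_data F V E \<iota>
    by (intro scalar_extension_data.intro scalar_extension_data_axioms.intro fD(1) E \<iota>)
  interpret W: scalar_extension_data F W E \<iota>
    by (intro scalar_extension_data.intro scalar_extension_data_axioms.intro fD(2) E \<iota>)
  obtain h where h: "linear_map E V.VE W.VE h"
    and hp: "\<And>e v. e \<in> carrier E \<Longrightarrow> v \<in> carrier V \<Longrightarrow> h (V.pure e v) = W.pure e (f v)"
    using scalar_extension_map[OF E \<iota> f] by blast
  obtain k where k: "linear_map E W.VE V.VE k"
    and kp: "\<And>e w. e \<in> carrier E \<Longrightarrow> w \<in> carrier W \<Longrightarrow> k (W.pure e w) = V.pure e (?g w)"
    using scalar_extension_map[OF E \<iota> g] by blast
  note hD = linear_mapD[OF h, unfolded V.extension_simps W.extension_simps]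
    and kD = linear_mapD[OF k, unfolded V.extension_simps W.extension_simps]
  have kh: "k (h S) = S" if "S \<in> carrier (V.G Mod V.N)" for S
    using that
  proof (induction rule: V.extension_induct)
    case zero
    show ?case by (simp only: hD(6) kD(6))
  next
    case (add S S')
    then show ?case by (simp only: hD(3,4) kD(4))
  next
    case (pure d v)
    then show ?case by (simp only: hp kp fD(3) gf)
  qed
  have hk: "h (k S) = S" if "S \<in> carrier (W.G Mod W.N)" for S
    using that
  proof (induction rule: W.extension_induct)
    case zero
    show ?case by (simp only: hD(6) kD(6))
  next
    case (add S S')
    then show ?case by (simp only: kD(3,4) hD(4))
  next
    case (pure d v)
    then show ?case by (simp only: hp kp gD(3) fg)
  qed
  show ?thesis
  proof (rule linear_map.dim_eq[OF h])
    show "V.VE.fin_dim" by (rule V.extension_fin_dim[OF V(2)])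
    show "inj_on h (carrier V.VE)"
      unfolding V.extension_simps by (rule inj_on_inverseI[where g = k]) (rule kh)
    show "h ` carrier V.VE = carrier W.VE"
      unfolding V.extension_simps W.extension_simps
    proof (intro equalityI image_subsetI subsetI)
      fix S assume "S \<in> carrier (W.G Mod W.N)"
      then show "S \<in> h ` carrier (V.G Mod V.N)" using hk kD(3) by (metis image_eqI)
    qed (rule hD(3))
  qed
qed

section \<open>Transfer of similarity factors\<close>

text \<open>The assumption \<open>stable\<close> says that \<open>E\<^sup>p\<close> preserves the values of \<open>\<phi>\<close>, so that the extended form has no new
  values, and the conclusion is the same property of \<open>\<psi>\<close>. By the equality of defects there is an isomorphism \<open>g\<close> of the
  anisotropic parts \<open>A\<close> and \<open>B\<close> of the extended forms. It need not be an isometry, but it parametrizes the values of the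
  extended \<open>\<psi>\<close> by the elements of \<open>A\<close>, hence by \<open>V\<close>. Thus these values form a set of dimension \<open>dim V = dim W\<close> over
  \<open>F\<close> which contains the values of \<open>\<psi>\<close>, and the two sets agree.\<close>

lemma scaled_values_transfer:
  fixes F :: "'a ring" and E :: "'e ring" and V :: "('a, 'v) module" and W :: "('a, 'w) module"
  assumes E: "field E" and \<iota>: "\<iota> \<in> ring_hom F E" and char: "has_characteristic E p"
    and \<phi>: "quasilinear_form p F V \<phi>" "anisotropic F V \<phi>"
    and \<psi>: "quasilinear_form p F W \<psi>" "anisotropic F W \<psi>"
    and dim: "vectorspace.dim F V = vectorspace.dim F W"
    and defect: "defect p E (scalar_extension F E \<iota> V) (extended_form p F E \<iota> V \<phi>) =
      defect p E (scalar_extension F E \<iota> W) (extended_form p F E \<iota> W \<psi>)"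
    and stable: "\<And>e v. e \<in> carrier E \<Longrightarrow> v \<in> carrier V \<Longrightarrow>
      e [^]\<^bsub>E\<^esub> p \<otimes>\<^bsub>E\<^esub> \<iota> (\<phi> v) \<in> (\<lambda>v. \<iota> (\<phi> v)) ` carrier V"
    and e: "e \<in> carrier E" and w: "w \<in> carrier W"
  shows "e [^]\<^bsub>E\<^esub> p \<otimes>\<^bsub>E\<^esub> \<iota> (\<psi> w) \<in> (\<lambda>w. \<iota> (\<psi> w)) ` carrier W"
proof -
  interpret \<phi>: quasilinear_form p F V \<phi> by fact
  interpret \<psi>: quasilinear_form p F W \<psi> by fact
  have V: "vectorspace F V" and W: "vectorspace F W" by unfold_locales
  have F: "field F" by unfold_locales
  interpret E: field E by fact
  interpret V: scalar_extension_data F V E \<iota>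
    by (intro scalar_extension_data.intro scalar_extension_data_axioms.intro V E \<iota>)
  interpret W: scalar_extension_data F W E \<iota>
    by (intro scalar_extension_data.intro scalar_extension_data_axioms.intro W E \<iota>)
  interpret \<iota>: ring_hom_ring F E \<iota> by (rule ring_hom_ringI2[OF \<phi>.R.ring_axioms E.ring_axioms \<iota>])
  have \<iota>_inj: "inj_on \<iota> (carrier F)" by (rule non_trivial_field_hom_is_inj[OF \<iota> F E])
  let ?\<Phi> = "extended_form p F E \<iota> V \<phi>" and ?\<Psi> = "extended_form p F E \<iota> W \<psi>"
  note \<Phi> = V.extended_form_properties[OF \<phi>(1) char]
    and \<Psi> = W.extended_form_properties[OF \<psi>(1) char]
  obtain A :: "('e, ('e \<times> 'v \<Rightarrow>\<^sub>0 int) set) module" and \<alpha> \<pi> where A: "quasilinear_form p E A \<alpha>" "anisotropic E A \<alpha>"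
    and \<pi>: "linear_map E V.VE A \<pi>" "\<pi> ` carrier V.VE = carrier A"
    and \<Phi>\<pi>: "\<And>S. S \<in> carrier V.VE \<Longrightarrow> ?\<Phi> S = \<alpha> (\<pi> S)"
    and dimA: "vectorspace.dim E A + defect p E V.VE ?\<Phi> = V.VE.dim"
    by (rule quasilinear_form.anisotropic_part[OF \<Phi>(1)]) (rule that; assumption)
  obtain B :: "('e, ('e \<times> 'w \<Rightarrow>\<^sub>0 int) set) module" and \<beta> \<rho> where B: "quasilinear_form p E B \<beta>" "anisotropic E B \<beta>"
    and \<rho>: "linear_map E W.VE B \<rho>" "\<rho> ` carrier W.VE = carrier B"
    and \<Psi>\<rho>: "\<And>S. S \<in> carrier W.VE \<Longrightarrow> ?\<Psi> S = \<beta> (\<rho> S)"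
    and dimB: "vectorspace.dim E B + defect p E W.VE ?\<Psi> = W.VE.dim"
    by (rule quasilinear_form.anisotropic_part[OF \<Psi>(1)]) (rule that; assumption)
  interpret A: quasilinear_form p E A \<alpha> by (rule A(1))
  interpret B: quasilinear_form p E B \<beta> by (rule B(1))
  have "V.VE.dim = W.VE.dim"
    by (rule scalar_extension_dim_cong[OF E \<iota> V \<phi>.finite_dimensional W \<psi>.finite_dimensional dim])
  then have dimAB: "vectorspace.dim E A = vectorspace.dim E B" using dimA dimB defect by linarith
  have Avs: "vectorspace E A" and Bvs: "vectorspace E B" by unfold_locales
  obtain g where g: "linear_map E A B g" "bij_betw g (carrier A) (carrier B)"
    using equal_dim_imp_linear_bij[OF Avs A.finite_dimensional Bvs B.finite_dimensional dimAB] by blast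
  note \<pi>D = linear_mapD[OF \<pi>(1), unfolded V.extension_simps] and gD = linear_mapD[OF g(1)]
  let ?one = "\<lambda>v. V.pure \<one>\<^bsub>E\<^esub> v"
  have one_closed: "?one v \<in> carrier (V.G Mod V.N)" if "v \<in> carrier V" for v
    using V.pure_closed[OF E.one_closed that] .
  have \<phi>_closed: "\<phi> v \<in> carrier F" if "v \<in> carrier V" for v by (rule funcset_mem[OF \<phi>.form_closed that])
  have \<psi>_closed: "\<psi> v \<in> carrier F" if "v \<in> carrier W" for v by (rule funcset_mem[OF \<psi>.form_closed that])
  have \<beta>_closed: "\<beta> b \<in> carrier E" if "b \<in> carrier B" for b by (rule funcset_mem[OF B.form_closed that])
  have \<alpha>_one: "\<alpha> (\<pi> (?one v)) = \<iota> (\<phi> v)" if v: "v \<in> carrier V" for v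
  proof -
    have "?\<Phi> (?one v) = \<iota> (\<phi> v)"
      using \<Phi>(2)[OF E.one_closed v] \<iota>.hom_closed[OF \<phi>_closed[OF v]] by simp
    moreover have "?\<Phi> (?one v) = \<alpha> (\<pi> (?one v))"
      by (rule \<Phi>\<pi>) (unfold V.extension_simps, rule one_closed[OF v])
    ultimately show ?thesis by simp
  qed
  have \<Phi>_values: "?\<Phi> S \<in> (\<lambda>v. \<iota> (\<phi> v)) ` carrier V" if "S \<in> carrier (V.G Mod V.N)" for S
    using that
  proof (induction rule: V.extension_induct)
    case zero
    have "?\<Phi> \<one>\<^bsub>V.G Mod V.N\<^esub> = \<iota> (\<phi> \<zero>\<^bsub>V\<^esub>)"
      using quasilinear_form.form_zero[OF \<Phi>(1), unfolded V.extension_simps]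
      by (simp only: \<phi>.form_zero \<iota>.hom_zero)
    then show ?case using \<phi>.M.zero_closed by blast
  next
    case (add S S')
    then obtain v v' where v: "v \<in> carrier V" "v' \<in> carrier V" "?\<Phi> S = \<iota> (\<phi> v)" "?\<Phi> S' = \<iota> (\<phi> v')"
      by blast
    have "?\<Phi> (S \<otimes>\<^bsub>V.G Mod V.N\<^esub> S') = ?\<Phi> S \<oplus>\<^bsub>E\<^esub> ?\<Phi> S'"
      using quasilinear_form.form_add[OF \<Phi>(1), unfolded V.extension_simps] add(1,2) by blast
    also have "\<dots> = \<iota> (\<phi> (v \<oplus>\<^bsub>V\<^esub> v'))"
      using v \<phi>_closed by (simp only: \<phi>.form_add \<iota>.hom_add)
    finally show ?case using \<phi>.M.a_closed[OF v(1,2)] by blast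
  next
    case (pure d v)
    then show ?case using stable by (simp only: \<Phi>(2))
  qed
  \<comment> \<open>The elements of \<open>A\<close> are determined by their values, which are values of \<open>\<phi>\<close>.\<close>
  have A_one: "\<exists>v\<in>carrier V. a = \<pi> (?one v)" if "a \<in> carrier A" for a
  proof -
    have "a \<in> \<pi> ` carrier V.VE" using that unfolding \<pi>(2) .
    then obtain S where S: "a = \<pi> S" "S \<in> carrier V.VE" by (rule imageE)
    note S = S(2,1)
    have "S \<in> carrier (V.G Mod V.N)" using S(1) unfolding V.extension_simps .
    from \<Phi>_values[OF this] obtain v where v: "?\<Phi> S = \<iota> (\<phi> v)" "v \<in> carrier V" by (rule imageE)
    note v = v(2,1)
    have "\<alpha> a = \<alpha> (\<pi> (?one v))"
      unfolding S(2) \<Phi>\<pi>[OF S(1), symmetric] v(2) \<alpha>_one[OF v(1)] ..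
    with A.anisotropic_imp_inj[OF A(2)] have "a = \<pi> (?one v)"
      using that \<pi>D(3)[OF one_closed[OF v(1)]] by (rule inj_onD)
    then show ?thesis using v(1) by blast
  qed
  \<comment> \<open>This map identifies \<open>V\<close> with the set of values of the extended \<open>\<psi>\<close>.\<close>
  let ?j = "\<lambda>v. \<beta> (g (\<pi> (?one v)))"
  have W_values: "\<beta> b \<in> ?j ` carrier V" if b: "b \<in> carrier B" for b
  proof -
    obtain a where "a \<in> carrier A" "b = g a" using b g(2) by (auto simp: bij_betw_def)
    then obtain v where "v \<in> carrier V" "b = g (\<pi> (?one v))" using A_one[of a] by blast
    then show ?thesis by (intro image_eqI[of _ _ v]) simp_all
  qed
  have \<Psi>_values: "d [^]\<^bsub>E\<^esub> p \<otimes>\<^bsub>E\<^esub> \<iota> (\<psi> u) \<in> ?j ` carrier V"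
    if "d \<in> carrier E" "u \<in> carrier W" for d u
  proof -
    have "W.pure d u \<in> carrier W.VE"
      unfolding W.extension_simps by (rule W.pure_closed[OF that])
    then have "\<rho> (W.pure d u) \<in> carrier B" and "?\<Psi> (W.pure d u) = \<beta> (\<rho> (W.pure d u))"
      unfolding \<rho>(2)[symmetric] by (rule imageI, rule \<Psi>\<rho>)
    then show ?thesis using W_values unfolding \<Psi>(2)[OF that] by (simp only:)
  qed
  have "(\<lambda>w. \<iota> (\<psi> w)) ` carrier W = ?j ` carrier V"
  proof (rule semilinear_factorization[OF W \<psi>.finite_dimensional V \<phi>.finite_dimensional dim[symmetric],
        of "\<lambda>w. \<iota> (\<psi> w)" "add E" "\<lambda>c y. \<iota> c [^]\<^bsub>E\<^esub> p \<otimes>\<^bsub>E\<^esub> y" ?j])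
    fix u u' assume "u \<in> carrier W" "u' \<in> carrier W"
    then show "\<iota> (\<psi> (u \<oplus>\<^bsub>W\<^esub> u')) = \<iota> (\<psi> u) \<oplus>\<^bsub>E\<^esub> \<iota> (\<psi> u')"
      by (simp only: \<psi>.form_add \<iota>.hom_add \<psi>_closed)
  next
    fix c u assume "c \<in> carrier F" "u \<in> carrier W"
    then show "\<iota> (\<psi> (c \<odot>\<^bsub>W\<^esub> u)) = \<iota> c [^]\<^bsub>E\<^esub> p \<otimes>\<^bsub>E\<^esub> \<iota> (\<psi> u)"
      by (simp only: \<psi>.form_smult \<iota>.hom_mult \<iota>.hom_nat_pow \<psi>_closed \<phi>.R.nat_pow_closed)
  next
    show "inj_on (\<lambda>w. \<iota> (\<psi> w)) (carrier W)"
      using \<iota>_inj \<psi>.anisotropic_imp_inj[OF \<psi>(2)] \<psi>_closed by (auto simp: inj_on_def)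
  next
    fix v v' assume "v \<in> carrier V" "v' \<in> carrier V"
    then show "?j (v \<oplus>\<^bsub>V\<^esub> v') = ?j v \<oplus>\<^bsub>E\<^esub> ?j v'"
      by (simp only: V.pure_add_right[OF E.one_closed] \<pi>D(3,4) one_closed gD(3,4) B.form_add)
  next
    fix c v assume cv: "c \<in> carrier F" "v \<in> carrier V"
    have "?one (c \<odot>\<^bsub>V\<^esub> v) = \<iota> c \<odot>\<^bsub>V.VE\<^esub> ?one v"
      using V.pure_balanced[OF E.one_closed cv] V.smult_pure[OF \<iota>.hom_closed[OF cv(1)] E.one_closed cv(2)]
        \<iota>.hom_closed[OF cv(1)] by simp
    then show "?j (c \<odot>\<^bsub>V\<^esub> v) = \<iota> c [^]\<^bsub>E\<^esub> p \<otimes>\<^bsub>E\<^esub> ?j v"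
      using cv by (simp only: \<pi>D(3,5) one_closed gD(3,5) B.form_smult \<iota>.hom_closed)
  next
    show "inj_on ?j (carrier V)"
    proof (rule inj_onI)
      fix v v' assume v: "v \<in> carrier V" "v' \<in> carrier V" and eq: "?j v = ?j v'"
      note cl = \<pi>D(3)[OF one_closed[OF v(1)]] \<pi>D(3)[OF one_closed[OF v(2)]]
      have "g (\<pi> (?one v)) = g (\<pi> (?one v'))"
        using B.anisotropic_imp_inj[OF B(2)] eq gD(3)[OF cl(1)] gD(3)[OF cl(2)] by (rule inj_onD)
      with bij_betw_imp_inj_on[OF g(2)] have "\<pi> (?one v) = \<pi> (?one v')" using cl by (rule inj_onD)
      then have "\<iota> (\<phi> v) = \<iota> (\<phi> v')" using \<alpha>_one v by metis
      with \<iota>_inj have "\<phi> v = \<phi> v'" using \<phi>_closed[OF v(1)] \<phi>_closed[OF v(2)] by (rule inj_onD)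
      with \<phi>.anisotropic_imp_inj[OF \<phi>(2)] show "v = v'" using v by (rule inj_onD)
    qed
  next
    show "(\<lambda>w. \<iota> (\<psi> w)) ` carrier W \<subseteq> ?j ` carrier V"
    proof (rule image_subsetI)
      fix u assume u: "u \<in> carrier W"
      show "\<iota> (\<psi> u) \<in> ?j ` carrier V"
        using \<Psi>_values[OF E.one_closed u] \<iota>.hom_closed[OF \<psi>_closed[OF u]] by simp
    qed
  qed
  then show ?thesis using \<Psi>_values[OF e w] by blast
qed

text \<open>The elements \<open>e\<close> whose \<open>p\<close>-th power preserves the values of \<open>\<phi>\<close> contain \<open>F\<close> and \<open>r\<close> and are closed under the
  field operations. Sums use the Frobenius identity. Inverses use that multiplication by \<open>e\<^sup>p\<close> on the
  values is an injective semilinear map of a finite-dimensional space, hence surjective.\<close>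

lemma radical_extension_stabilizes:
  assumes p: "prime p" and \<phi>: "quasilinear_form p F V \<phi>" "anisotropic F V \<phi>"
    and L: "field L" and \<iota>: "\<iota> \<in> ring_hom F L"
    and x: "x \<in> carrier F" and r: "r \<in> carrier L" "r [^]\<^bsub>L\<^esub> p = \<iota> x"
    and stable: "\<And>v. v \<in> carrier V \<Longrightarrow> x \<otimes>\<^bsub>F\<^esub> \<phi> v \<in> \<phi> ` carrier V"
    and e: "e \<in> generate_field L (\<iota> ` carrier F \<union> {r})" and v: "v \<in> carrier V"
  shows "e [^]\<^bsub>L\<^esub> p \<otimes>\<^bsub>L\<^esub> \<iota> (\<phi> v) \<in> (\<lambda>v. \<iota> (\<phi> v)) ` carrier V"
proof -
  interpret \<phi>: quasilinear_form p F V \<phi> by fact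
  interpret L: field L by fact
  interpret \<iota>: ring_hom_ring F L \<iota> by (rule ring_hom_ringI2[OF \<phi>.R.ring_axioms L.ring_axioms \<iota>])
  have F: "field F" and V: "vectorspace F V" by unfold_locales
  have \<iota>_inj: "inj_on \<iota> (carrier F)" by (rule non_trivial_field_hom_is_inj[OF \<iota> F L])
  have charL: "[p] \<cdot>\<^bsub>L\<^esub> \<one>\<^bsub>L\<^esub> = \<zero>\<^bsub>L\<^esub>"
    by (rule L.has_characteristic_add_pow[OF has_characteristic_hom[OF F L \<iota> p \<phi>.characteristic]])
  let ?H = "\<iota> ` carrier F \<union> {r}"
  have H: "?H \<subseteq> carrier L" using r by auto
  have \<phi>_closed: "\<phi> v \<in> carrier F" if "v \<in> carrier V" for v by (rule funcset_mem[OF \<phi>.form_closed that])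
  let ?D = "(\<lambda>v. \<iota> (\<phi> v)) ` carrier V"
  have D_closed: "y \<in> carrier L" if "y \<in> ?D" for y using that \<phi>_closed by auto
  have D_add: "y \<oplus>\<^bsub>L\<^esub> y' \<in> ?D" if y: "y \<in> ?D" "y' \<in> ?D" for y y'
  proof -
    obtain u u' where u: "u \<in> carrier V" "u' \<in> carrier V" "y = \<iota> (\<phi> u)" "y' = \<iota> (\<phi> u')"
      using y by auto
    then have "y \<oplus>\<^bsub>L\<^esub> y' = \<iota> (\<phi> (u \<oplus>\<^bsub>V\<^esub> u'))"
      by (simp only: \<phi>.form_add \<iota>.hom_add \<phi>_closed)
    then show ?thesis using \<phi>.M.a_closed[OF u(1,2)] by blast
  qed
  have D_scale: "\<iota> c [^]\<^bsub>L\<^esub> p \<otimes>\<^bsub>L\<^esub> y \<in> ?D" if c: "c \<in> carrier F" and y: "y \<in> ?D" for c y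
  proof -
    obtain u where u: "u \<in> carrier V" "y = \<iota> (\<phi> u)" using y by auto
    then have "\<iota> c [^]\<^bsub>L\<^esub> p \<otimes>\<^bsub>L\<^esub> y = \<iota> (\<phi> (c \<odot>\<^bsub>V\<^esub> u))"
      using c by (simp only: \<phi>.form_smult \<iota>.hom_mult \<iota>.hom_nat_pow \<phi>_closed \<phi>.R.nat_pow_closed)
    then show ?thesis using \<phi>.smult_closed[OF c u(1)] by blast
  qed
  have D_surj: "y \<in> (\<lambda>y. h [^]\<^bsub>L\<^esub> p \<otimes>\<^bsub>L\<^esub> y) ` ?D"
    if h: "h \<in> carrier L" "h \<noteq> \<zero>\<^bsub>L\<^esub>" and hD: "\<And>y. y \<in> ?D \<Longrightarrow> h [^]\<^bsub>L\<^esub> p \<otimes>\<^bsub>L\<^esub> y \<in> ?D" and y: "y \<in> ?D" for h y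
  proof -
    have hp: "h [^]\<^bsub>L\<^esub> p \<in> carrier L" "h [^]\<^bsub>L\<^esub> p \<noteq> \<zero>\<^bsub>L\<^esub>"
      using h L.nat_pow_nonzero by auto
    have "(\<lambda>v. h [^]\<^bsub>L\<^esub> p \<otimes>\<^bsub>L\<^esub> \<iota> (\<phi> v)) ` carrier V = ?D"
    proof (rule semilinear_factorization[OF V \<phi>.finite_dimensional V \<phi>.finite_dimensional refl,
          of "\<lambda>v. h [^]\<^bsub>L\<^esub> p \<otimes>\<^bsub>L\<^esub> \<iota> (\<phi> v)" "add L" "\<lambda>c y. \<iota> c [^]\<^bsub>L\<^esub> p \<otimes>\<^bsub>L\<^esub> y" "\<lambda>v. \<iota> (\<phi> v)"])
      have inj: "inj_on (\<lambda>v. \<iota> (\<phi> v)) (carrier V)"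
        using \<iota>_inj \<phi>.anisotropic_imp_inj[OF \<phi>(2)] \<phi>_closed by (auto simp: inj_on_def)
      then show "inj_on (\<lambda>v. \<iota> (\<phi> v)) (carrier V)" .
      show "inj_on (\<lambda>v. h [^]\<^bsub>L\<^esub> p \<otimes>\<^bsub>L\<^esub> \<iota> (\<phi> v)) (carrier V)"
        using inj hp \<phi>_closed by (auto simp: inj_on_def L.m_lcancel)
    next
      fix u u' assume u: "u \<in> carrier V" "u' \<in> carrier V"
      then show "\<iota> (\<phi> (u \<oplus>\<^bsub>V\<^esub> u')) = \<iota> (\<phi> u) \<oplus>\<^bsub>L\<^esub> \<iota> (\<phi> u')"
        by (simp only: \<phi>.form_add \<iota>.hom_add \<phi>_closed)
      then show "h [^]\<^bsub>L\<^esub> p \<otimes>\<^bsub>L\<^esub> \<iota> (\<phi> (u \<oplus>\<^bsub>V\<^esub> u')) =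
          h [^]\<^bsub>L\<^esub> p \<otimes>\<^bsub>L\<^esub> \<iota> (\<phi> u) \<oplus>\<^bsub>L\<^esub> h [^]\<^bsub>L\<^esub> p \<otimes>\<^bsub>L\<^esub> \<iota> (\<phi> u')"
        using hp u \<phi>_closed by (simp only: L.r_distr \<iota>.hom_closed)
    next
      fix c u assume c: "c \<in> carrier F" "u \<in> carrier V"
      then show "\<iota> (\<phi> (c \<odot>\<^bsub>V\<^esub> u)) = \<iota> c [^]\<^bsub>L\<^esub> p \<otimes>\<^bsub>L\<^esub> \<iota> (\<phi> u)"
        by (simp only: \<phi>.form_smult \<iota>.hom_mult \<iota>.hom_nat_pow \<phi>_closed \<phi>.R.nat_pow_closed)
      then show "h [^]\<^bsub>L\<^esub> p \<otimes>\<^bsub>L\<^esub> \<iota> (\<phi> (c \<odot>\<^bsub>V\<^esub> u)) =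
          \<iota> c [^]\<^bsub>L\<^esub> p \<otimes>\<^bsub>L\<^esub> (h [^]\<^bsub>L\<^esub> p \<otimes>\<^bsub>L\<^esub> \<iota> (\<phi> u))"
        using hp c \<phi>_closed by (simp add: L.m_lcomm)
    next
      show "(\<lambda>v. h [^]\<^bsub>L\<^esub> p \<otimes>\<^bsub>L\<^esub> \<iota> (\<phi> v)) ` carrier V \<subseteq> ?D" using hD by blast
    qed
    then show ?thesis using y by (simp add: image_image)
  qed
  have "\<forall>y\<in>?D. e [^]\<^bsub>L\<^esub> p \<otimes>\<^bsub>L\<^esub> y \<in> ?D"
    using e
  proof (induction rule: generate_field.induct)
    case one
    then show ?case using D_closed by simp
  next
    case (incl h)
    show ?case
    proof (cases "h = r")
      case True
      have "\<iota> x \<otimes>\<^bsub>L\<^esub> \<iota> (\<phi> u) \<in> ?D" if u: "u \<in> carrier V" for u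
      proof -
        obtain u' where "u' \<in> carrier V" "x \<otimes>\<^bsub>F\<^esub> \<phi> u = \<phi> u'" using stable[OF u] by blast
        then have "\<iota> x \<otimes>\<^bsub>L\<^esub> \<iota> (\<phi> u) = \<iota> (\<phi> u')" using \<iota>.hom_mult[OF x \<phi>_closed[OF u]] by (simp only:)
        then show ?thesis using \<open>u' \<in> carrier V\<close> by (rule image_eqI)
      qed
      then show ?thesis unfolding True r(2) by (intro ballI) (erule imageE, simp only:)
    next
      case False
      then obtain c where c: "c \<in> carrier F" "h = \<iota> c" using incl by auto
      show ?thesis unfolding c(2) by (intro ballI D_scale[OF c(1)])
    qed
  next
    case (a_inv h)
    have h: "h \<in> carrier L" by (rule L.generate_field_in_carrier[OF H a_inv(1)])
    \<comment> \<open>Writing \<open>\<ominus> h\<close> as \<open>\<iota> (\<ominus> 1) h\<close> covers \<open>p = 2\<close> and odd \<open>p\<close> alike.\<close>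
    have "(\<ominus>\<^bsub>L\<^esub> h) [^]\<^bsub>L\<^esub> p = \<iota> (\<ominus>\<^bsub>F\<^esub> \<one>\<^bsub>F\<^esub>) [^]\<^bsub>L\<^esub> p \<otimes>\<^bsub>L\<^esub> h [^]\<^bsub>L\<^esub> p"
      using h by (simp add: L.nat_pow_distrib[symmetric] L.l_minus)
    then have "(\<ominus>\<^bsub>L\<^esub> h) [^]\<^bsub>L\<^esub> p \<otimes>\<^bsub>L\<^esub> y =
        \<iota> (\<ominus>\<^bsub>F\<^esub> \<one>\<^bsub>F\<^esub>) [^]\<^bsub>L\<^esub> p \<otimes>\<^bsub>L\<^esub> (h [^]\<^bsub>L\<^esub> p \<otimes>\<^bsub>L\<^esub> y)" if "y \<in> ?D" for y
      using h D_closed[OF that] by (simp add: L.m_assoc)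
    then show ?case using D_scale[of "\<ominus>\<^bsub>F\<^esub> \<one>\<^bsub>F\<^esub>"] bspec[OF a_inv(2)] by simp
  next
    case (m_inv h)
    have h: "h \<in> carrier L" by (rule L.generate_field_in_carrier[OF H m_inv(1)])
    have hi: "inv\<^bsub>L\<^esub> h \<in> carrier L" "inv\<^bsub>L\<^esub> h \<otimes>\<^bsub>L\<^esub> h = \<one>\<^bsub>L\<^esub>"
      using h m_inv(2) L.field_Units by auto
    show ?case
    proof
      fix y assume y: "y \<in> ?D"
      have "y \<in> (\<lambda>y. h [^]\<^bsub>L\<^esub> p \<otimes>\<^bsub>L\<^esub> y) ` ?D"
        by (rule D_surj[OF h m_inv(2) _ y]) (rule bspec[OF m_inv(3)])
      then obtain z where "y = h [^]\<^bsub>L\<^esub> p \<otimes>\<^bsub>L\<^esub> z" "z \<in> ?D" by (rule imageE)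
      note z = this(2,1)
      have "inv\<^bsub>L\<^esub> h [^]\<^bsub>L\<^esub> p \<otimes>\<^bsub>L\<^esub> y = (inv\<^bsub>L\<^esub> h \<otimes>\<^bsub>L\<^esub> h) [^]\<^bsub>L\<^esub> p \<otimes>\<^bsub>L\<^esub> z"
        using h hi(1) D_closed[OF z(1)] by (simp add: z(2) L.nat_pow_distrib L.m_assoc)
      then show "inv\<^bsub>L\<^esub> h [^]\<^bsub>L\<^esub> p \<otimes>\<^bsub>L\<^esub> y \<in> ?D" using z(1) D_closed[OF z(1)] by (simp add: hi(2))
    qed
  next
    case (eng_add h h')
    have h: "h \<in> carrier L" "h' \<in> carrier L"
      using L.generate_field_in_carrier[OF H] eng_add(1,2) by blast+
    show ?case
    proof
      fix y assume y: "y \<in> ?D"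
      have "(h \<oplus>\<^bsub>L\<^esub> h') [^]\<^bsub>L\<^esub> p \<otimes>\<^bsub>L\<^esub> y = h [^]\<^bsub>L\<^esub> p \<otimes>\<^bsub>L\<^esub> y \<oplus>\<^bsub>L\<^esub> h' [^]\<^bsub>L\<^esub> p \<otimes>\<^bsub>L\<^esub> y"
        using h D_closed[OF y] by (simp add: L.frobenius_add[OF p charL] L.l_distr)
      then show "(h \<oplus>\<^bsub>L\<^esub> h') [^]\<^bsub>L\<^esub> p \<otimes>\<^bsub>L\<^esub> y \<in> ?D"
        using D_add[OF bspec[OF eng_add(3) y] bspec[OF eng_add(4) y]] by (simp only:)
    qed
  next
    case (eng_mult h h')
    have h: "h \<in> carrier L" "h' \<in> carrier L"
      using L.generate_field_in_carrier[OF H] eng_mult(1,2) by blast+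
    show ?case
    proof
      fix y assume y: "y \<in> ?D"
      have "(h \<otimes>\<^bsub>L\<^esub> h') [^]\<^bsub>L\<^esub> p \<otimes>\<^bsub>L\<^esub> y = h [^]\<^bsub>L\<^esub> p \<otimes>\<^bsub>L\<^esub> (h' [^]\<^bsub>L\<^esub> p \<otimes>\<^bsub>L\<^esub> y)"
        using h D_closed[OF y] by (simp add: L.nat_pow_distrib L.m_assoc)
      then show "(h \<otimes>\<^bsub>L\<^esub> h') [^]\<^bsub>L\<^esub> p \<otimes>\<^bsub>L\<^esub> y \<in> ?D"
        using bspec[OF eng_mult(3) bspec[OF eng_mult(4) y]] by (simp only:)
    qed
  qed
  then show ?thesis using v by blast
qed

text \<open>The two previous lemmas are applied to \<open>E = F(r)\<close> with \<open>r\<^sup>p = x\<close>: since \<open>E\<^sup>p\<close> preserves the values of \<open>\<phi>\<close>, it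
  preserves those of \<open>\<psi>\<close>, and \<open>r\<^sup>p = x\<close> belongs to it.\<close>

lemma similarity_factors_transfer:
  assumes p: "prime p" and F: "field F" and char: "has_characteristic F p"
    and \<phi>: "quasilinear_form p F V \<phi>" "anisotropic F V \<phi>"
    and \<psi>: "quasilinear_form p F W \<psi>" "anisotropic F W \<psi>"
    and equiv: "weakly_Vishik_equivalent p F V \<phi> W \<psi>"
  shows "similarity_factors F V \<phi> \<subseteq> similarity_factors F W \<psi>"
proof
  fix x assume x\<phi>: "x \<in> similarity_factors F V \<phi>"
  show "x \<in> similarity_factors F W \<psi>"
  proof (cases "x = \<zero>\<^bsub>F\<^esub>")
    case True
    then show ?thesis by (simp add: similarity_factors_def)
  next
    case False
    then have x: "x \<in> carrier F" using x\<phi> by (simp add: similarity_factors_def)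
    interpret F: field F by (rule F)
    let ?L = "F.alg_closure" and ?\<iota> = "closure_embedding F"
    interpret L: algebraic_closure ?L "?\<iota> ` carrier F" by (rule F.alg_closureE(1))
    have L: "field ?L" by (rule L.field_axioms)
    note hom = F.alg_closureE(2)
    define r where "r = pth_root p F x"
    note r = pth_root_properties[OF F p char x, folded r_def]
    let ?H = "?\<iota> ` carrier F \<union> {r}"
    have H: "?H \<subseteq> carrier ?L" using r ring_hom_closed[OF hom] by auto
    define E where "E = ?L \<lparr>carrier := generate_field ?L ?H\<rparr>"
    have E_eq: "pth_root_extension p F x = E" by (simp add: pth_root_extension_def E_def r_def)
    have E: "field E" unfolding E_def by (rule L.generate_field_is_field[OF H])
    have carrE: "carrier E = generate_field ?L ?H" by (simp add: E_def)
    have multE: "y \<otimes>\<^bsub>E\<^esub> z = y \<otimes>\<^bsub>?L\<^esub> z" for y z by (simp add: E_def)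
    have powE: "y [^]\<^bsub>E\<^esub> n = y [^]\<^bsub>?L\<^esub> n" for y and n :: nat
      unfolding E_def by (rule L.nat_pow_consistent[symmetric])
    have homE: "?\<iota> \<in> ring_hom F E"
      using hom by (auto simp: ring_hom_def E_def intro: generate_field.incl)
    have rE: "r \<in> carrier E" unfolding carrE by (rule generate_field.incl) simp
    interpret \<phi>: quasilinear_form p F V \<phi> by (rule \<phi>(1))
    interpret \<psi>: quasilinear_form p F W \<psi> by (rule \<psi>(1))
    have stable: "\<And>v. v \<in> carrier V \<Longrightarrow> x \<otimes>\<^bsub>F\<^esub> \<phi> v \<in> \<phi> ` carrier V"
      using \<phi>.similarity_factor_iff[OF \<phi>(2) x False] x\<phi> by blast
    have dim: "vectorspace.dim F V = vectorspace.dim F W"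
      and defect: "defect p E (scalar_extension F E ?\<iota> V) (extended_form p F E ?\<iota> V \<phi>) =
        defect p E (scalar_extension F E ?\<iota> W) (extended_form p F E ?\<iota> W \<psi>)"
      using equiv x unfolding weakly_Vishik_equivalent_def E_eq[symmetric] Let_def by blast+
    have "x \<otimes>\<^bsub>F\<^esub> \<psi> w \<in> \<psi> ` carrier W" if w: "w \<in> carrier W" for w
    proof -
      have "r [^]\<^bsub>E\<^esub> p \<otimes>\<^bsub>E\<^esub> ?\<iota> (\<psi> w) \<in> (\<lambda>w. ?\<iota> (\<psi> w)) ` carrier W"
      proof (rule scaled_values_transfer[OF E homE has_characteristic_hom[OF F E homE p char]
            \<phi> \<psi> dim defect _ rE w])
        fix e v assume "e \<in> carrier E" "v \<in> carrier V"
        then show "e [^]\<^bsub>E\<^esub> p \<otimes>\<^bsub>E\<^esub> ?\<iota> (\<phi> v) \<in> (\<lambda>v. ?\<iota> (\<phi> v)) ` carrier V"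
          unfolding multE powE carrE
          by (intro radical_extension_stabilizes[OF p \<phi> L hom x r stable])
      qed
      then obtain w' where w': "w' \<in> carrier W" "?\<iota> x \<otimes>\<^bsub>?L\<^esub> ?\<iota> (\<psi> w) = ?\<iota> (\<psi> w')"
        unfolding multE powE r(2) by blast
      have \<psi>_closed: "\<psi> u \<in> carrier F" if "u \<in> carrier W" for u
        by (rule funcset_mem[OF \<psi>.form_closed that])
      have "?\<iota> (x \<otimes>\<^bsub>F\<^esub> \<psi> w) = ?\<iota> (\<psi> w')"
        using w' ring_hom_mult[OF hom x \<psi>_closed[OF w]] by simp
      with F.indexed_const_inj_on have "x \<otimes>\<^bsub>F\<^esub> \<psi> w = \<psi> w'"
        using F.m_closed[OF x \<psi>_closed[OF w]] \<psi>_closed[OF w'(1)] by (rule inj_onD)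
      then show ?thesis using w'(1) by blast
    qed
    then show ?thesis using \<psi>.similarity_factor_iff[OF \<psi>(2) x False] by blast
  qed
qed

theorem theorem3p7:
  fixes p :: nat
    and F :: "'a ring"
    and V :: "('a, 'v) module" and \<phi> :: "'v \<Rightarrow> 'a"
    and W :: "('a, 'w) module" and \<psi> :: "'w \<Rightarrow> 'a"
  assumes "prime p" and "field F" and "has_characteristic F p"
    and "quasilinear_form p F V \<phi>" and "anisotropic F V \<phi>"
    and "quasilinear_form p F W \<psi>" and "anisotropic F W \<psi>"
    and "weakly_Vishik_equivalent p F V \<phi> W \<psi>"
  shows "similarity_factors F V \<phi> = similarity_factors F W \<psi>"
proof
  show "similarity_factors F V \<phi> \<subseteq> similarity_factors F W \<psi>"
    by (rule similarity_factors_transfer[OF assms])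
  have "weakly_Vishik_equivalent p F W \<psi> V \<phi>"
    using assms(8) unfolding weakly_Vishik_equivalent_def Let_def by metis
  then show "similarity_factors F W \<psi> \<subseteq> similarity_factors F V \<phi>"
    by (rule similarity_factors_transfer[OF assms(1-3,6,7,4,5)])
qed

end
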